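(* Consider the Approximated Whittle Index (AWI) algorithm described in the context, for $N$ channels, $T$ time steps, $K$ CQI levels and $n_{\mathrm{iter}}$ iteration steps in solving for the priority index. The complexity of the algorithm is $O(NTK^{n_{\mathrm{iter}}})$. Furthermore, suppose that for each channel (superscripts suppressed) $p_{11}\ne p_{01}$ and the discount factor $\beta\in(0,1)$ satisfies $$\beta \le \begin{cases}\dfrac{1}{2(p_{11}-p_{01})\left[1+\sum_{i\in P}(p_{i,1}-p_{i,0})\right]}, & p_{11}>p_{01},\\[2ex] \dfrac{1}{(p_{01}-p_{11})\left[3+4\sum_{i\in P}(p_{i,1}-p_{i,0})\right]}, & p_{01}>p_{11},\end{cases}\qquad P=\{i: p_{i,1}-p_{i,0}\ge0\},$$ and $0<\beta\le\tfrac12$. Then, as $n_{\mathrm{iter}}$ increases, the priority index of a channel in belief state $\omega$ computed by the algorithm converges to the exact Whittle index $W(\omega)$ at a geometric rate, i.e. the error is bounded by $c\rho^{\,n_{\mathrm{iter}}}$ for some constants $c<\infty$ and $\rho\in(0,1)$.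
   Context: Model. There are $N$ independent channels, of which $M$ ($1\le M<N$) are selected (active) at each time. Channel $n$ has hidden state $S_n(t)$ following a Markov chain on $\{0,1\}$ with transition probabilities $p_{01}^{(n)}$ (from $0$ to $1$) and $p_{11}^{(n)}$ (from $1$ to $1$), $p_{01}^{(n)},p_{11}^{(n)}\in(0,1)$, $p_{01}^{(n)}\ne p_{11}^{(n)}$, and throughput $B_n$. An active channel in state $s$ yields reward $sB_n$ and produces observation $i\in\{1,\dots,K\}$ with probability $p_{i,s}^{(n)}$ (so $\sum_i p_{i,s}^{(n)}=1$); a passive channel yields no reward and no observation. Below the superscript $(n)$ is dropped. The belief $\omega\in[0,1]$ is the conditional probability that the state is $1$. Put $\mathcal T(\omega)=p_{11}\omega+p_{01}(1-\omega)$, $p_i(\omega)=p_{i,1}\omega+p_{i,0}(1-\omega)$, $\phi_i(\omega)=p_{i,1}\omega/p_i(\omega)$, $\omega_i=\mathcal T(\phi_i(\omega))$. The belief becomes $\mathcal T(\omega)$ after passivity and $\omega_i$ after activation with observation $i$. Exact Whittle index. With throughput normalized to $B=1$ and subsidy $m\in\mathbb R$ for passivity, $V_{\beta,m}$ is the maximal expected infinite-horizon $\beta$-discounted reward of the single channel, so $V_{\beta,m}(\omega)=\max\{V_{\beta,m}(\omega;a=0),V_{\beta,m}(\omega;a=1)\}$ with $V_{\beta,m}(\omega;a=0)=m+\beta V_{\beta,m}(\mathcal T(\omega))$ and $V_{\beta,m}(\omega;a=1)=\omega+\beta\sum_{i=1}^K p_i(\omega)V_{\beta,m}(\omega_i)$.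 The Whittle index is $W(\omega)=\inf\{m: V_{\beta,m}(\omega;a=1)=V_{\beta,m}(\omega;a=0)\}$. For general $B$ the exact and approximated indices are $B$ times those for $B=1$. Approximated index (for $B=1$). Fix the threshold $\omega^*=\omega$, the current belief. For a belief $x$ let $L=L(x,\omega^* )=\min\{k\ge0:\mathcal T^k(x)>\omega^*\}$ ($+\infty$ if there is none), $b_1(x)=\frac{1-\beta^L}{1-\beta}$, $b_2(x)=\beta^L$, $\Omega(x)=\mathcal T^L(x)$, $b_{3,i}(x)=\beta^{L+1}p_i(\mathcal T^L(x))$, $f_i(x)=\mathcal T(\phi_i(\mathcal T^L(x)))$; when $L=+\infty$, $\beta^L=0$ and all terms containing $b_2(x)$ or $b_{3,i}(x)$ are zero. (Terms with zero-probability observations are zero.) Set $k_0=b_1$, $a_0=b_2\Omega$, and for $j\ge1$, $k_j(x)=k_0(x)+\sum_{i}b_{3,i}(x)k_{j-1}(f_i(x))$, $a_j(x)=a_0(x)+\sum_i b_{3,i}(x)a_{j-1}(f_i(x))$. The $j$-iteration approximated Whittle index is $$\widehat W_j(\omega)=\frac{\omega+\beta\left(\sum_{i=1}^K p_i(\omega)a_j(\omega_i)-a_j(\mathcal T(\omega))\right)}{1+\beta\left(k_j(\mathcal T(\omega))-\sum_{i=1}^K p_i(\omega)k_j(\omega_i)\right)},$$ if the denominator is nonzero. AWI algorithm. Input: $\beta\in(0,1)$, $T\ge1$, $N\ge2$, $1\le M<N$, $n_{\mathrm{iter}}\ge0$, the initial beliefs and the channel parameters. For each $t=1,\dots,T$: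 for each channel compute the priority index, equal to $\widehat W_{n_{\mathrm{iter}}}(\omega_n(t))$ if it exists and to $\omega_n(t)B_n$ otherwise; select the $M$ channels with the largest priority indices; observe them and collect their rewards; update all beliefs, setting, for each channel $n$ with its own parameters, $\omega_n(t+1)=\mathcal T(\omega_n(t))$ if channel $n$ was not selected at time $t$, and $\omega_n(t+1)=\mathcal T(\phi_i(\omega_n(t)))$ if channel $n$ was selected at time $t$ and produced observation $i$. The complexity is the number of elementary operations.
   Formalization: The constant in O(NTK^{n_iter}) may depend on K, and for K=1 also on n_iter, since a uniform constant is impossible: already for n_iter=0 all K observation probabilities are read, and for K=1 the recursion takes time linear in n_iter. *)

theory Defs
  imports "HOL-Probability.Probability" "HOL-Library.Extended_Nat"
begin

section \<open>A channel and its belief dynamics\<close>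

text \<open>\<open>emit c s\<close> is the distribution of the observation produced by an active channel in
  state \<open>s\<close>, where \<open>True\<close> stands for state 1.\<close>

record channel =
  p01 :: real
  p11 :: real
  bw :: real
  emit :: "bool \<Rightarrow> nat pmf"

definition valid_channel :: "nat \<Rightarrow> channel \<Rightarrow> bool" where
  "valid_channel K c \<longleftrightarrow> 0 < p01 c \<and> p01 c < 1 \<and> 0 < p11 c \<and> p11 c < 1 \<and> p01 c \<noteq> p11 c \<and>
     (\<forall>s. set_pmf (emit c s) \<subseteq> {1..K})"

definition pobs :: "channel \<Rightarrow> nat \<Rightarrow> bool \<Rightarrow> real" where
  "pobs c i s = pmf (emit c s) i"

definition evolve :: "channel \<Rightarrow> real \<Rightarrow> real" where
  "evolve c w = p11 c * w + p01 c * (1 - w)"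

definition obs_prob :: "channel \<Rightarrow> nat \<Rightarrow> real \<Rightarrow> real" where
  "obs_prob c i w = pobs c i True * w + pobs c i False * (1 - w)"

definition posterior :: "channel \<Rightarrow> nat \<Rightarrow> real \<Rightarrow> real" where
  "posterior c i w = pobs c i True * w / obs_prob c i w"

definition post_evolve :: "channel \<Rightarrow> nat \<Rightarrow> real \<Rightarrow> real" where
  "post_evolve c i w = evolve c (posterior c i w)"


section \<open>The exact Whittle index\<close>

text \<open>A policy decides from the history whether to activate the channel. A history lists the
  past slots, latest first: \<open>None\<close> for a passive slot, \<open>Some i\<close> for an active slot with
  observation \<open>i\<close>. \<open>process c \<pi> w t\<close> is the joint law of the history and of the hidden state at
  time \<open>t\<close> when the initial state is 1 with probability \<open>w\<close>.\<close>

type_synonym policy = "nat option list \<Rightarrow> bool"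

primrec process :: "channel \<Rightarrow> policy \<Rightarrow> real \<Rightarrow> nat \<Rightarrow> (nat option list \<times> bool) pmf" where
  "process c \<pi> w 0 = map_pmf (\<lambda>s. ([], s)) (bernoulli_pmf w)"
| "process c \<pi> w (Suc t) = do {
     (h, s) \<leftarrow> process c \<pi> w t;
     y \<leftarrow> (if \<pi> h then map_pmf Some (emit c s) else return_pmf None);
     s' \<leftarrow> bernoulli_pmf (if s then p11 c else p01 c);
     return_pmf (y # h, s')
   }"

text \<open>Expected discounted reward for throughput 1 and subsidy \<open>m\<close> for passivity.\<close>

definition policy_value :: "real \<Rightarrow> real \<Rightarrow> channel \<Rightarrow> policy \<Rightarrow> real \<Rightarrow> real" where
  "policy_value \<beta> m c \<pi> w =
     (\<Sum>t. \<beta> ^ t * measure_pmf.expectation (process c \<pi> w t)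
                     (\<lambda>(h, s). if \<pi> h then of_bool s else m))"

definition opt_value :: "real \<Rightarrow> real \<Rightarrow> channel \<Rightarrow> real \<Rightarrow> real" where
  "opt_value \<beta> m c w = (SUP \<pi>. policy_value \<beta> m c \<pi> w)"

definition value_passive :: "real \<Rightarrow> real \<Rightarrow> channel \<Rightarrow> real \<Rightarrow> real" where
  "value_passive \<beta> m c w = m + \<beta> * opt_value \<beta> m c (evolve c w)"

definition value_active :: "nat \<Rightarrow> real \<Rightarrow> real \<Rightarrow> channel \<Rightarrow> real \<Rightarrow> real" where
  "value_active K \<beta> m c w =
     w + \<beta> * (\<Sum>i=1..K. obs_prob c i w * opt_value \<beta> m c (post_evolve c i w))"

definition whittle_index :: "nat \<Rightarrow> real \<Rightarrow> channel \<Rightarrow> real \<Rightarrow> real" where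
  "whittle_index K \<beta> c w = bw c * Inf {m. value_active K \<beta> m c w = value_passive \<beta> m c w}"


section \<open>The approximated Whittle index\<close>

text \<open>\<open>hit c ws x\<close> is the number of passive slots until the belief exceeds the threshold \<open>ws\<close>
  (the infimum of the empty set is \<open>\<infinity>\<close>).\<close>

definition hit :: "channel \<Rightarrow> real \<Rightarrow> real \<Rightarrow> enat" where
  "hit c ws x = Inf (enat ` {k. (evolve c ^^ k) x > ws})"

definition disc :: "real \<Rightarrow> enat \<Rightarrow> real" where
  "disc \<beta> L = (case L of enat l \<Rightarrow> \<beta> ^ l | \<infinity> \<Rightarrow> 0)"

text \<open>If \<open>hit c ws x = \<infinity>\<close> then \<open>hit_belief c ws x\<close> is irrelevant: it only occurs in terms with
  the factor \<open>disc \<beta> \<infinity> = 0\<close>.\<close>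

definition hit_belief :: "channel \<Rightarrow> real \<Rightarrow> real \<Rightarrow> real" where
  "hit_belief c ws x = (evolve c ^^ the_enat (hit c ws x)) x"

definition b1 :: "real \<Rightarrow> channel \<Rightarrow> real \<Rightarrow> real \<Rightarrow> real" where
  "b1 \<beta> c ws x = (1 - disc \<beta> (hit c ws x)) / (1 - \<beta>)"

definition b2 :: "real \<Rightarrow> channel \<Rightarrow> real \<Rightarrow> real \<Rightarrow> real" where
  "b2 \<beta> c ws x = disc \<beta> (hit c ws x)"

definition b3 :: "real \<Rightarrow> channel \<Rightarrow> real \<Rightarrow> nat \<Rightarrow> real \<Rightarrow> real" where
  "b3 \<beta> c ws i x = \<beta> * disc \<beta> (hit c ws x) * obs_prob c i (hit_belief c ws x)"

definition next_belief :: "channel \<Rightarrow> real \<Rightarrow> nat \<Rightarrow> real \<Rightarrow> real" where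
  "next_belief c ws i x = post_evolve c i (hit_belief c ws x)"

primrec k_iter :: "nat \<Rightarrow> real \<Rightarrow> channel \<Rightarrow> real \<Rightarrow> nat \<Rightarrow> real \<Rightarrow> real" where
  "k_iter K \<beta> c ws 0 x = b1 \<beta> c ws x"
| "k_iter K \<beta> c ws (Suc j) x =
     b1 \<beta> c ws x + (\<Sum>i=1..K. b3 \<beta> c ws i x * k_iter K \<beta> c ws j (next_belief c ws i x))"

primrec a_iter :: "nat \<Rightarrow> real \<Rightarrow> channel \<Rightarrow> real \<Rightarrow> nat \<Rightarrow> real \<Rightarrow> real" where
  "a_iter K \<beta> c ws 0 x = b2 \<beta> c ws x * hit_belief c ws x"
| "a_iter K \<beta> c ws (Suc j) x =
     b2 \<beta> c ws x * hit_belief c ws x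
       + (\<Sum>i=1..K. b3 \<beta> c ws i x * a_iter K \<beta> c ws j (next_belief c ws i x))"

definition approx_num :: "nat \<Rightarrow> real \<Rightarrow> nat \<Rightarrow> channel \<Rightarrow> real \<Rightarrow> real" where
  "approx_num K \<beta> j c w = w + \<beta> * ((\<Sum>i=1..K. obs_prob c i w * a_iter K \<beta> c w j (post_evolve c i w))
                                   - a_iter K \<beta> c w j (evolve c w))"

definition approx_den :: "nat \<Rightarrow> real \<Rightarrow> nat \<Rightarrow> channel \<Rightarrow> real \<Rightarrow> real" where
  "approx_den K \<beta> j c w = 1 + \<beta> * (k_iter K \<beta> c w j (evolve c w)
                                   - (\<Sum>i=1..K. obs_prob c i w * k_iter K \<beta> c w j (post_evolve c i w)))"

definition priority_index :: "nat \<Rightarrow> real \<Rightarrow> nat \<Rightarrow> channel \<Rightarrow> real \<Rightarrow> real" where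
  "priority_index K \<beta> j c w =
     (if approx_den K \<beta> j c w \<noteq> 0 then bw c * (approx_num K \<beta> j c w / approx_den K \<beta> j c w)
      else w * bw c)"


section \<open>Runs of the AWI policy\<close>

definition top_selection :: "nat \<Rightarrow> real list \<Rightarrow> bool list \<Rightarrow> bool" where
  "top_selection M keys sel \<longleftrightarrow> length sel = length keys \<and> card {n. n < length sel \<and> sel ! n} = M \<and>
     (\<forall>n n'. n < length sel \<longrightarrow> n' < length sel \<longrightarrow> sel ! n \<longrightarrow> \<not> sel ! n' \<longrightarrow> keys ! n' \<le> keys ! n)"

text \<open>\<open>env t n\<close> is the pair of the state and the observation that channel \<open>n\<close> shows at time \<open>t\<close>
  if it is then active. Time slots are counted from 0.\<close>

type_synonym environment = "nat \<Rightarrow> nat \<Rightarrow> bool \<times> nat"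

definition next_beliefs ::
  "channel list \<Rightarrow> real list \<Rightarrow> bool list \<Rightarrow> (nat \<Rightarrow> bool \<times> nat) \<Rightarrow> real list" where
  "next_beliefs cs ws sel e =
     map (\<lambda>n. if sel ! n then post_evolve (cs ! n) (snd (e n)) (ws ! n) else evolve (cs ! n) (ws ! n))
         [0..<length cs]"

definition slot_reward :: "channel list \<Rightarrow> bool list \<Rightarrow> (nat \<Rightarrow> bool \<times> nat) \<Rightarrow> real" where
  "slot_reward cs sel e = (\<Sum>n<length cs. if sel ! n then of_bool (fst (e n)) * bw (cs ! n) else 0)"

text \<open>\<open>awi_run K \<beta> j M cs env t ws out\<close>: from time \<open>t\<close> and beliefs \<open>ws\<close> on, the list \<open>out\<close> of
  selections and collected rewards is one that the algorithm may produce (ties between priority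
  indices may be broken arbitrarily).\<close>

fun awi_run :: "nat \<Rightarrow> real \<Rightarrow> nat \<Rightarrow> nat \<Rightarrow> channel list \<Rightarrow> environment \<Rightarrow> nat \<Rightarrow> real list
                 \<Rightarrow> (bool list \<times> real) list \<Rightarrow> bool" where
  "awi_run K \<beta> j M cs env t ws [] \<longleftrightarrow> True"
| "awi_run K \<beta> j M cs env t ws ((sel, r) # out) \<longleftrightarrow>
     top_selection M (map2 (priority_index K \<beta> j) cs ws) sel \<and>
     r = slot_reward cs sel (env t) \<and>
     awi_run K \<beta> j M cs env (Suc t) (next_beliefs cs ws sel (env t)) out"

text \<open>Admissible inputs and environments of the algorithm.\<close>

definition awi_input :: "nat \<Rightarrow> nat \<Rightarrow> nat \<Rightarrow> nat \<Rightarrow> real \<Rightarrow> channel list \<Rightarrow> real list \<Rightarrow> environment \<Rightarrow> bool"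
  where
  "awi_input K N M T \<beta> cs ws env \<longleftrightarrow> 0 < \<beta> \<and> \<beta> < 1 \<and> 1 \<le> T \<and> 2 \<le> N \<and> 1 \<le> M \<and> M < N \<and>
     length cs = N \<and> (\<forall>c\<in>set cs. valid_channel K c) \<and>
     length ws = N \<and> (\<forall>w\<in>set ws. 0 \<le> w \<and> w \<le> 1) \<and>
     (\<forall>t n. snd (env t n) \<in> {1..K})"


section \<open>Counting elementary operations\<close>

text \<open>Programs over a real random access machine return their result together with the number
  of elementary operations executed. Elementary are: reading a variable or constant and returning a
  value (\<open>ret\<close>), and arithmetic operations, comparisons, powers, logarithms and rounding (\<open>op1\<close>
  and \<open>op2\<close>). Every function call executes at least one \<open>ret\<close>, hence is charged.\<close>

datatype 'a tm = TM (val: 'a) (time: nat)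

definition ret :: "'a \<Rightarrow> 'a tm" where
  "ret x = TM x 1"

definition bind_tm :: "'a tm \<Rightarrow> ('a \<Rightarrow> 'b tm) \<Rightarrow> 'b tm" where
  "bind_tm m f = TM (val (f (val m))) (time m + time (f (val m)))"

adhoc_overloading Monad_Syntax.bind \<rightleftharpoons> bind_tm

definition op1 :: "('a \<Rightarrow> 'b) \<Rightarrow> 'a tm \<Rightarrow> 'b tm" where
  "op1 f x = TM (f (val x)) (time x + 1)"

definition op2 :: "('a \<Rightarrow> 'b \<Rightarrow> 'c) \<Rightarrow> 'a tm \<Rightarrow> 'b tm \<Rightarrow> 'c tm" where
  "op2 f x y = TM (f (val x) (val y)) (time x + time y + 1)"

abbreviation add_tm :: "'a::plus tm \<Rightarrow> 'a tm \<Rightarrow> 'a tm" (infixl \<open>\<oplus>\<close> 65) where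
  "x \<oplus> y \<equiv> op2 (+) x y"

abbreviation sub_tm :: "'a::minus tm \<Rightarrow> 'a tm \<Rightarrow> 'a tm" (infixl \<open>\<ominus>\<close> 65) where
  "x \<ominus> y \<equiv> op2 (-) x y"

abbreviation mult_tm :: "'a::times tm \<Rightarrow> 'a tm \<Rightarrow> 'a tm" (infixl \<open>\<otimes>\<close> 70) where
  "x \<otimes> y \<equiv> op2 (*) x y"

abbreviation div_tm :: "real tm \<Rightarrow> real tm \<Rightarrow> real tm" (infixl \<open>\<oslash>\<close> 70) where
  "x \<oslash> y \<equiv> op2 (/) x y"

abbreviation pow_tm :: "real tm \<Rightarrow> nat tm \<Rightarrow> real tm" (infixr \<open>\<up>\<close> 80) where
  "x \<up> n \<equiv> op2 (^) x n"

abbreviation less_tm :: "'a::ord tm \<Rightarrow> 'a tm \<Rightarrow> bool tm" (infix \<open>\<prec>\<close> 50) where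
  "x \<prec> y \<equiv> op2 (<) x y"

abbreviation eq_tm :: "'a tm \<Rightarrow> 'a tm \<Rightarrow> bool tm" (infix \<open>\<doteq>\<close> 50) where
  "x \<doteq> y \<equiv> op2 (=) x y"

primrec sum_tm :: "nat \<Rightarrow> (nat \<Rightarrow> real tm) \<Rightarrow> real tm" where
  "sum_tm 0 f = ret 0"
| "sum_tm (Suc k) f = sum_tm k f \<oplus> f (Suc k)"

primrec map_tm :: "('a \<Rightarrow> 'b tm) \<Rightarrow> 'a list \<Rightarrow> 'b list tm" where
  "map_tm f [] = ret []"
| "map_tm f (x # xs) = do { y \<leftarrow> f x; ys \<leftarrow> map_tm f xs; ret (y # ys) }"

fun zip_tm :: "'a list \<Rightarrow> 'b list \<Rightarrow> ('a \<times> 'b) list tm" where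
  "zip_tm (x # xs) (y # ys) = do { zs \<leftarrow> zip_tm xs ys; ret ((x, y) # zs) }"
| "zip_tm _ _ = ret []"

primrec length_tm :: "'a list \<Rightarrow> nat tm" where
  "length_tm [] = ret 0"
| "length_tm (x # xs) = length_tm xs \<oplus> ret 1"

fun nth_tm :: "real list \<Rightarrow> nat \<Rightarrow> real tm" where
  "nth_tm [] k = ret 0"
| "nth_tm (x # xs) k = do {
     z \<leftarrow> ret k \<doteq> ret 0;
     if z then ret x else do { k' \<leftarrow> ret k \<ominus> ret 1; nth_tm xs k' }
   }"


subsection \<open>Priority indices\<close>

definition evolve_tm :: "channel \<Rightarrow> real \<Rightarrow> real tm" where
  "evolve_tm c w = ret (p11 c) \<otimes> ret w \<oplus> ret (p01 c) \<otimes> (ret 1 \<ominus> ret w)"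

definition obs_prob_tm :: "channel \<Rightarrow> nat \<Rightarrow> real \<Rightarrow> real tm" where
  "obs_prob_tm c i w = ret (pobs c i True) \<otimes> ret w \<oplus> ret (pobs c i False) \<otimes> (ret 1 \<ominus> ret w)"

definition post_evolve_tm :: "channel \<Rightarrow> nat \<Rightarrow> real \<Rightarrow> real tm" where
  "post_evolve_tm c i w = do {
     v \<leftarrow> (ret (pobs c i True) \<otimes> ret w) \<oslash> obs_prob_tm c i w;
     evolve_tm c v
   }"

text \<open>Passive beliefs approach the fixed point \<open>p01 / (1 - p11 + p01)\<close> of \<open>evolve c\<close> by the factor
  \<open>p11 - p01\<close> per slot. This gives the iterates of \<open>evolve c\<close> and the hitting times (\<open>None\<close> for
  \<open>\<infinity>\<close>) in closed form.\<close>

definition iter_evolve_tm :: "channel \<Rightarrow> nat \<Rightarrow> real \<Rightarrow> real tm" where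
  "iter_evolve_tm c l x = do {
     d \<leftarrow> ret (p11 c) \<ominus> ret (p01 c);
     f \<leftarrow> ret (p01 c) \<oslash> (ret 1 \<ominus> ret d);
     ret f \<oplus> ret d \<up> ret l \<otimes> (ret x \<ominus> ret f)
   }"

definition hit_tm :: "channel \<Rightarrow> real \<Rightarrow> real \<Rightarrow> nat option tm" where
  "hit_tm c ws x = do {
     above \<leftarrow> ret ws \<prec> ret x;
     if above then ret (Some 0)
     else do {
       pos \<leftarrow> ret (p01 c) \<prec> ret (p11 c);
       if pos then do {
         d \<leftarrow> ret (p11 c) \<ominus> ret (p01 c);
         u \<leftarrow> ret (p01 c) \<ominus> ret ws \<otimes> (ret 1 \<ominus> ret d);
         v \<leftarrow> ret (p01 c) \<ominus> ret x \<otimes> (ret 1 \<ominus> ret d);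
         reached \<leftarrow> ret 0 \<prec> ret u;
         if reached then do {
           q \<leftarrow> ret u \<oslash> ret v;
           l \<leftarrow> op1 (\<lambda>y. nat \<lfloor>y\<rfloor>) (op2 log (ret d) (ret q)) \<oplus> ret 1;
           ret (Some l)
         }
         else ret None
       }
       else do {
         y \<leftarrow> evolve_tm c x;
         reached \<leftarrow> ret ws \<prec> ret y;
         if reached then ret (Some 1) else ret None
       }
     }
   }"

primrec k_tm :: "nat \<Rightarrow> real \<Rightarrow> channel \<Rightarrow> real \<Rightarrow> nat \<Rightarrow> real \<Rightarrow> real tm" where
  "k_tm K \<beta> c ws 0 x = do {
     L \<leftarrow> hit_tm c ws x;
     case L of
       None \<Rightarrow> ret 1 \<oslash> (ret 1 \<ominus> ret \<beta>)
     | Some l \<Rightarrow> (ret 1 \<ominus> ret \<beta> \<up> ret l) \<oslash> (ret 1 \<ominus> ret \<beta>)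
   }"
| "k_tm K \<beta> c ws (Suc j) x = do {
     L \<leftarrow> hit_tm c ws x;
     case L of
       None \<Rightarrow> ret 1 \<oslash> (ret 1 \<ominus> ret \<beta>)
     | Some l \<Rightarrow> do {
         b \<leftarrow> ret \<beta> \<up> ret l;
         y \<leftarrow> iter_evolve_tm c l x;
         s \<leftarrow> sum_tm K (\<lambda>i. do {
           q \<leftarrow> obs_prob_tm c i y;
           z \<leftarrow> post_evolve_tm c i y;
           r \<leftarrow> k_tm K \<beta> c ws j z;
           ret \<beta> \<otimes> ret b \<otimes> ret q \<otimes> ret r
         });
         (ret 1 \<ominus> ret b) \<oslash> (ret 1 \<ominus> ret \<beta>) \<oplus> ret s
       }
   }"

primrec a_tm :: "nat \<Rightarrow> real \<Rightarrow> channel \<Rightarrow> real \<Rightarrow> nat \<Rightarrow> real \<Rightarrow> real tm" where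
  "a_tm K \<beta> c ws 0 x = do {
     L \<leftarrow> hit_tm c ws x;
     case L of
       None \<Rightarrow> ret 0
     | Some l \<Rightarrow> do { y \<leftarrow> iter_evolve_tm c l x; ret \<beta> \<up> ret l \<otimes> ret y }
   }"
| "a_tm K \<beta> c ws (Suc j) x = do {
     L \<leftarrow> hit_tm c ws x;
     case L of
       None \<Rightarrow> ret 0
     | Some l \<Rightarrow> do {
         b \<leftarrow> ret \<beta> \<up> ret l;
         y \<leftarrow> iter_evolve_tm c l x;
         s \<leftarrow> sum_tm K (\<lambda>i. do {
           q \<leftarrow> obs_prob_tm c i y;
           z \<leftarrow> post_evolve_tm c i y;
           r \<leftarrow> a_tm K \<beta> c ws j z;
           ret \<beta> \<otimes> ret b \<otimes> ret q \<otimes> ret r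
         });
         ret b \<otimes> ret y \<oplus> ret s
       }
   }"

definition priority_tm :: "nat \<Rightarrow> real \<Rightarrow> nat \<Rightarrow> channel \<Rightarrow> real \<Rightarrow> real tm" where
  "priority_tm K \<beta> j c w = do {
     v \<leftarrow> evolve_tm c w;
     a \<leftarrow> a_tm K \<beta> c w j v;
     k \<leftarrow> k_tm K \<beta> c w j v;
     sa \<leftarrow> sum_tm K (\<lambda>i. do {
       q \<leftarrow> obs_prob_tm c i w; z \<leftarrow> post_evolve_tm c i w; r \<leftarrow> a_tm K \<beta> c w j z; ret q \<otimes> ret r });
     sk \<leftarrow> sum_tm K (\<lambda>i. do {
       q \<leftarrow> obs_prob_tm c i w; z \<leftarrow> post_evolve_tm c i w; r \<leftarrow> k_tm K \<beta> c w j z; ret q \<otimes> ret r });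
     num \<leftarrow> ret w \<oplus> ret \<beta> \<otimes> (ret sa \<ominus> ret a);
     den \<leftarrow> ret 1 \<oplus> ret \<beta> \<otimes> (ret k \<ominus> ret sk);
     z \<leftarrow> ret den \<doteq> ret 0;
     if z then ret w \<otimes> ret (bw c) else ret (bw c) \<otimes> (ret num \<oslash> ret den)
   }"


subsection \<open>Selecting the channels with the largest indices\<close>

text \<open>Sorting all \<open>N\<close> indices would cost an extra factor \<open>log N\<close>. The \<open>M\<close>-th largest index is
  therefore found by the median-of-medians method.\<close>

primrec insert_tm :: "real \<Rightarrow> real list \<Rightarrow> real list tm" where
  "insert_tm x [] = ret [x]"
| "insert_tm x (y # ys) = do {
     b \<leftarrow> ret y \<prec> ret x;
     if b then ret (x # y # ys) else do { zs \<leftarrow> insert_tm x ys; ret (y # zs) }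
   }"

primrec isort_tm :: "real list \<Rightarrow> real list tm" where
  "isort_tm [] = ret []"
| "isort_tm (x # xs) = do { ys \<leftarrow> isort_tm xs; insert_tm x ys }"

fun medians_tm :: "real list \<Rightarrow> real list tm" where
  "medians_tm (a # b # c # d # e # xs) = do {
     ys \<leftarrow> isort_tm [a, b, c, d, e];
     m \<leftarrow> nth_tm ys 2;
     ms \<leftarrow> medians_tm xs;
     ret (m # ms)
   }"
| "medians_tm _ = ret []"

text \<open>Splits a list into the elements above the pivot, the number of elements equal to it, and
  the elements below it.\<close>

primrec partition_tm :: "real \<Rightarrow> real list \<Rightarrow> (real list \<times> nat \<times> real list) tm" where
  "partition_tm p [] = ret ([], 0, [])"
| "partition_tm p (x # xs) = do {
     (gs, ne, ls) \<leftarrow> partition_tm p xs;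
     g \<leftarrow> ret p \<prec> ret x;
     if g then ret (x # gs, ne, ls)
     else do {
       l \<leftarrow> ret x \<prec> ret p;
       if l then ret (gs, ne, x # ls) else do { ne' \<leftarrow> ret ne \<oplus> ret 1; ret (gs, ne', ls) }
     }
   }"

text \<open>\<open>kth_tm f k xs\<close> finds the element at position \<open>k\<close> (from 0) in the descending order of
  \<open>xs\<close>; \<open>f\<close> bounds the depth of the recursion, and \<open>f = length xs\<close> is never exhausted.\<close>

primrec kth_tm :: "nat \<Rightarrow> nat \<Rightarrow> real list \<Rightarrow> real tm" where
  "kth_tm 0 k xs = do { ys \<leftarrow> isort_tm xs; nth_tm ys k }"
| "kth_tm (Suc f) k xs = do {
     n \<leftarrow> length_tm xs;
     small \<leftarrow> ret n \<prec> ret 25;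
     if small then do { ys \<leftarrow> isort_tm xs; nth_tm ys k }
     else do {
       ms \<leftarrow> medians_tm xs;
       nm \<leftarrow> length_tm ms;
       h \<leftarrow> op2 (div) (ret nm) (ret 2);
       p \<leftarrow> kth_tm f h ms;
       (gs, ne, ls) \<leftarrow> partition_tm p xs;
       ng \<leftarrow> length_tm gs;
       ngt \<leftarrow> ret k \<prec> ret ng;
       if ngt then kth_tm f k gs
       else do {
         nge \<leftarrow> ret ng \<oplus> ret ne;
         eq \<leftarrow> ret k \<prec> ret nge;
         if eq then ret p else do { k' \<leftarrow> ret k \<ominus> ret nge; kth_tm f k' ls }
       }
     }
   }"

text \<open>Marks all keys above \<open>v\<close> and the first \<open>r\<close> keys equal to \<open>v\<close>.\<close>

primrec mark_tm :: "real \<Rightarrow> nat \<Rightarrow> real list \<Rightarrow> bool list tm" where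
  "mark_tm v r [] = ret []"
| "mark_tm v r (x # xs) = do {
     g \<leftarrow> ret v \<prec> ret x;
     if g then do { bs \<leftarrow> mark_tm v r xs; ret (True # bs) }
     else do {
       e \<leftarrow> ret x \<doteq> ret v;
       pos \<leftarrow> ret 0 \<prec> ret r;
       take_it \<leftarrow> op2 (\<and>) (ret e) (ret pos);
       if take_it then do { r' \<leftarrow> ret r \<ominus> ret 1; bs \<leftarrow> mark_tm v r' xs; ret (True # bs) }
       else do { bs \<leftarrow> mark_tm v r xs; ret (False # bs) }
     }
   }"

definition select_tm :: "nat \<Rightarrow> real list \<Rightarrow> bool list tm" where
  "select_tm M keys = do {
     n \<leftarrow> length_tm keys;
     k \<leftarrow> ret M \<ominus> ret 1;
     v \<leftarrow> kth_tm n k keys;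
     (gs, ne, ls) \<leftarrow> partition_tm v keys;
     ng \<leftarrow> length_tm gs;
     r \<leftarrow> ret M \<ominus> ret ng;
     mark_tm v r keys
   }"


subsection \<open>The AWI algorithm\<close>

text \<open>Collects the rewards of the selected channels and updates all beliefs; \<open>n\<close> is the number of
  the first channel in the list.\<close>

fun observe_tm :: "(nat \<Rightarrow> bool \<times> nat) \<Rightarrow> nat \<Rightarrow> (channel \<times> real) list \<Rightarrow> bool list
                    \<Rightarrow> ((channel \<times> real) list \<times> real) tm" where
  "observe_tm e n ((c, w) # xs) (b # bs) = do {
     (w', r) \<leftarrow> (if b
       then do {
         (s, i) \<leftarrow> ret (e n);
         w' \<leftarrow> post_evolve_tm c i w;
         r \<leftarrow> (if s then ret (bw c) else ret 0);
         ret (w', r)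
       }
       else do { w' \<leftarrow> evolve_tm c w; ret (w', 0) });
     n' \<leftarrow> ret n \<oplus> ret 1;
     (ys, rs) \<leftarrow> observe_tm e n' xs bs;
     rs' \<leftarrow> ret r \<oplus> ret rs;
     ret ((c, w') # ys, rs')
   }"
| "observe_tm e n _ _ = ret ([], 0)"

primrec awi_loop_tm :: "nat \<Rightarrow> real \<Rightarrow> nat \<Rightarrow> nat \<Rightarrow> environment \<Rightarrow> nat \<Rightarrow> nat \<Rightarrow> (channel \<times> real) list
                         \<Rightarrow> (bool list \<times> real) list tm" where
  "awi_loop_tm K \<beta> j M env 0 t xs = ret []"
| "awi_loop_tm K \<beta> j M env (Suc T) t xs = do {
     keys \<leftarrow> map_tm (\<lambda>(c, w). priority_tm K \<beta> j c w) xs;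
     sel \<leftarrow> select_tm M keys;
     (ys, r) \<leftarrow> observe_tm (env t) 0 xs sel;
     t' \<leftarrow> ret t \<oplus> ret 1;
     out \<leftarrow> awi_loop_tm K \<beta> j M env T t' ys;
     ret ((sel, r) # out)
   }"

definition awi_tm :: "nat \<Rightarrow> real \<Rightarrow> nat \<Rightarrow> nat \<Rightarrow> nat \<Rightarrow> channel list \<Rightarrow> real list \<Rightarrow> environment
                       \<Rightarrow> (bool list \<times> real) list tm" where
  "awi_tm K \<beta> j M T cs ws env = do {
     xs \<leftarrow> zip_tm cs ws;
     awi_loop_tm K \<beta> j M env T 0 xs
   }"


section \<open>The condition on the discount factor\<close>

definition gain_sum :: "nat \<Rightarrow> channel \<Rightarrow> real" where
  "gain_sum K c = (\<Sum>i \<in> {i\<in>{1..K}. pobs c i True - pobs c i False \<ge> 0}. pobs c i True - pobs c i False)"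

definition discount_bound :: "nat \<Rightarrow> channel \<Rightarrow> real" where
  "discount_bound K c =
     (if p11 c > p01 c then 1 / (2 * (p11 c - p01 c) * (1 + gain_sum K c))
      else 1 / ((p01 c - p11 c) * (3 + 4 * gain_sum K c)))"


section \<open>The program implements the specification\<close>

lemma val_simps [simp]:
  "val (ret x) = x"
  "val (bind_tm m f) = val (f (val m))"
  "val (op1 g y) = g (val y)"
  "val (op2 h u v) = h (val u) (val v)"
  by (simp_all add: ret_def bind_tm_def op1_def op2_def)

lemma val_sum_tm [simp]: "val (sum_tm K f) = (\<Sum>i=1..K. val (f i))"
  by (induction K) simp_all

lemma val_map_tm [simp]: "val (map_tm f xs) = map (\<lambda>x. val (f x)) xs"
  by (induction xs) simp_all

lemma val_zip_tm [simp]: "val (zip_tm xs ys) = zip xs ys"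
  by (induction xs ys rule: zip_tm.induct) simp_all

lemma val_length_tm [simp]: "val (length_tm xs) = length xs"
  by (induction xs) simp_all

lemma val_nth_tm [simp]: "k < length xs \<Longrightarrow> val (nth_tm xs k) = xs ! k"
  by (induction xs arbitrary: k) (auto simp: nth_Cons')

lemma val_evolve_tm [simp]: "val (evolve_tm c w) = evolve c w"
  by (simp add: evolve_tm_def evolve_def)

lemma val_obs_prob_tm [simp]: "val (obs_prob_tm c i w) = obs_prob c i w"
  by (simp add: obs_prob_tm_def obs_prob_def)

lemma val_post_evolve_tm [simp]: "val (post_evolve_tm c i w) = post_evolve c i w"
  by (simp add: post_evolve_tm_def post_evolve_def posterior_def)

definition fixpt :: "channel \<Rightarrow> real" where
  "fixpt c = p01 c / (1 - (p11 c - p01 c))"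

lemma evolve_funpow:
  assumes "valid_channel K c"
  shows "(evolve c ^^ l) x = fixpt c + (p11 c - p01 c) ^ l * (x - fixpt c)"
proof (induction l)
  case (Suc l)
  have "1 - (p11 c - p01 c) \<noteq> 0" using assms by (auto simp: valid_channel_def)
  hence f: "fixpt c = p01 c + (p11 c - p01 c) * fixpt c"
    by (simp add: fixpt_def field_simps)
  have "evolve c y = fixpt c + (p11 c - p01 c) * (y - fixpt c)" for y
    unfolding evolve_def using f by (simp add: algebra_simps)
  thus ?case using Suc by simp
qed simp

lemma val_iter_evolve_tm [simp]:
  "valid_channel K c \<Longrightarrow> val (iter_evolve_tm c l x) = (evolve c ^^ l) x"
  by (simp add: evolve_funpow iter_evolve_tm_def fixpt_def)

definition to_enat :: "nat option \<Rightarrow> enat" where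
  "to_enat L = (case L of None \<Rightarrow> \<infinity> | Some l \<Rightarrow> enat l)"

lemma hit_eq_enat:
  assumes "(evolve c ^^ l) x > ws" "\<And>k. (evolve c ^^ k) x > ws \<Longrightarrow> l \<le> k"
  shows "hit c ws x = enat l"
  unfolding hit_def by (rule cInf_eq_minimum) (use assms in auto)

lemma hit_eq_infinity:
  assumes "\<And>k. (evolve c ^^ k) x \<le> ws"
  shows "hit c ws x = \<infinity>"
proof -
  have "{k. (evolve c ^^ k) x > ws} = {}" using assms by (auto simp: not_less)
  thus ?thesis unfolding hit_def by (simp add: top_enat_def)
qed

lemma val_hit_tm:
  assumes "valid_channel K c"
  shows "to_enat (val (hit_tm c ws x)) = hit c ws x"
proof -
  let ?d = "p11 c - p01 c"
  let ?f = "fixpt c"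
  have d: "-1 < ?d" "?d < 1" "?d \<noteq> 0" using assms by (auto simp: valid_channel_def)
  have fd: "p01 c = ?f * (1 - ?d)" using d by (simp add: fixpt_def)
  have it: "(evolve c ^^ k) x = ?f + ?d ^ k * (x - ?f)" for k
    by (rule evolve_funpow[OF assms])
  consider "ws < x" | "x \<le> ws" "0 < ?d" "ws < ?f" | "x \<le> ws" "0 < ?d" "?f \<le> ws"
    | "x \<le> ws" "?d < 0" "ws < evolve c x" | "x \<le> ws" "?d < 0" "evolve c x \<le> ws"
    using d by linarith
  thus ?thesis
  proof cases
    case 1
    have "hit c ws x = enat 0" by (rule hit_eq_enat) (use 1 in auto)
    thus ?thesis using 1 by (simp add: hit_tm_def to_enat_def)
  next
    case 2
    define q where "q = (?f - ws) / (?f - x)"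
    have q: "0 < q" "q \<le> 1" using 2 by (auto simp: q_def)
    have u: "p01 c - ws * (1 - ?d) = (?f - ws) * (1 - ?d)" "p01 c - x * (1 - ?d) = (?f - x) * (1 - ?d)"
      by (subst fd, simp add: algebra_simps)+
    have uq: "(p01 c - ws * (1 - ?d)) / (p01 c - x * (1 - ?d)) = q"
      unfolding u q_def using d by simp
    have upos: "0 < p01 c - ws * (1 - ?d)"
      unfolding u using d 2 by simp
    have lnd: "ln ?d < 0" using d 2 by simp
    have pass: "(evolve c ^^ k) x > ws \<longleftrightarrow> log ?d q < real k" for k
    proof -
      have "(evolve c ^^ k) x > ws \<longleftrightarrow> ?d ^ k * (?f - x) < ?f - ws"
        unfolding it by (simp add: algebra_simps)
      also have "\<dots> \<longleftrightarrow> ?d ^ k < q" using 2 by (simp add: q_def field_simps)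
      also have "\<dots> \<longleftrightarrow> ln (?d ^ k) < ln q" using q 2 by (subst ln_less_cancel_iff) auto
      also have "\<dots> \<longleftrightarrow> real k * ln ?d < ln q" using 2 by (simp add: ln_realpow)
      also have "\<dots> \<longleftrightarrow> log ?d q < real k" using lnd by (simp add: log_def field_simps)
      finally show ?thesis .
    qed
    have "log ?d q \<ge> 0" unfolding log_def using lnd q by (simp add: divide_nonpos_neg)
    hence lt: "log ?d q < real k \<longleftrightarrow> nat \<lfloor>log ?d q\<rfloor> + 1 \<le> k" for k
      by linarith
    have "hit c ws x = enat (nat \<lfloor>log ?d q\<rfloor> + 1)"
      by (rule hit_eq_enat) (simp_all only: pass lt)
    moreover have "val (hit_tm c ws x) = Some (nat \<lfloor>log ?d q\<rfloor> + 1)"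
      using 2 upos uq by (simp add: hit_tm_def Let_def)
    ultimately show ?thesis by (simp add: to_enat_def)
  next
    case 3
    have "(evolve c ^^ k) x \<le> ws" for k
    proof (cases "x \<le> ?f")
      case True
      hence "?d ^ k * (x - ?f) \<le> 0" using 3 by (intro mult_nonneg_nonpos) auto
      thus ?thesis unfolding it using 3 by linarith
    next
      case False
      have "?d ^ k \<le> 1" using 3 d by (intro power_le_one) auto
      hence "?d ^ k * (x - ?f) \<le> 1 * (x - ?f)" using False by (intro mult_right_mono) auto
      hence "?f + ?d ^ k * (x - ?f) \<le> x" by simp
      thus ?thesis unfolding it using 3(1) by (rule order.trans)
    qed
    hence "hit c ws x = \<infinity>" by (rule hit_eq_infinity)
    moreover have "\<not> 0 < p01 c - ws * (1 - ?d)"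
    proof -
      have "p01 c - ws * (1 - ?d) = (?f - ws) * (1 - ?d)" by (subst fd, simp add: algebra_simps)
      thus ?thesis using 3 d by (simp add: mult_nonpos_nonneg not_less)
    qed
    ultimately show ?thesis using 3 by (simp add: hit_tm_def to_enat_def)
  next
    case 4
    have "hit c ws x = enat 1"
    proof (rule hit_eq_enat)
      fix k assume "ws < (evolve c ^^ k) x"
      thus "1 \<le> k" using 4 by (cases k) auto
    qed (use 4 in simp)
    thus ?thesis using 4 by (simp add: hit_tm_def to_enat_def one_enat_def)
  next
    case 5
    have tx: "evolve c x = ?f + ?d * (x - ?f)" using it[of 1] by simp
    have f: "?f \<le> ws"
    proof (cases "x \<le> ?f")
      case True
      hence "0 \<le> ?d * (x - ?f)" using 5 by (intro mult_nonpos_nonpos) auto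
      thus ?thesis using tx 5 by linarith
    qed (use 5 in linarith)
    have cvx: "?f + e * (y - ?f) \<le> ws" if "0 \<le> e" "e \<le> 1" "y \<le> ws" for e y
    proof -
      have "?f + e * (y - ?f) = (1 - e) * ?f + e * y" by (simp add: algebra_simps)
      also have "\<dots> \<le> (1 - e) * ws + e * ws" using that f by (intro add_mono mult_left_mono) auto
      finally show ?thesis by (simp add: algebra_simps)
    qed
    have e: "0 \<le> ?d ^ (2 * m)" "?d ^ (2 * m) \<le> 1" for m
    proof -
      have "?d\<^sup>2 \<le> 1" using d by (simp add: abs_square_le_1)
      thus "?d ^ (2 * m) \<le> 1" unfolding power_mult by (rule power_le_one[rotated]) simp
    qed simp
    have "(evolve c ^^ k) x \<le> ws" for k
    proof (cases "even k")
      case True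
      then obtain m where "k = 2 * m" by blast
      thus ?thesis unfolding it using cvx[OF e[of m]] 5 by simp
    next
      case False
      then obtain m where "k = 2 * m + 1" by (blast elim: oddE)
      hence "(evolve c ^^ k) x = ?f + ?d ^ (2 * m) * (evolve c x - ?f)"
        unfolding it tx by (simp add: algebra_simps)
      thus ?thesis using cvx[OF e[of m]] 5 by simp
    qed
    hence "hit c ws x = \<infinity>" by (rule hit_eq_infinity)
    thus ?thesis using 5 by (simp add: hit_tm_def to_enat_def)
  qed
qed

lemma val_k_tm [simp]:
  assumes "valid_channel K c"
  shows "val (k_tm K \<beta> c ws j x) = k_iter K \<beta> c ws j x"
proof (induction j arbitrary: x)
  case 0
  show ?case 
    by (auto simp: val_hit_tm[OF assms, symmetric] b1_def disc_def to_enat_def split: option.splits)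
next
  case (Suc j)
  show ?case using Suc
    by (auto simp: val_hit_tm[OF assms, symmetric] b1_def b3_def disc_def to_enat_def next_belief_def hit_belief_def
          val_iter_evolve_tm[OF assms] mult_ac
        split: option.splits)
qed

lemma val_a_tm [simp]:
  assumes "valid_channel K c"
  shows "val (a_tm K \<beta> c ws j x) = a_iter K \<beta> c ws j x"
proof (induction j arbitrary: x)
  case 0
  show ?case 
    by (auto simp: val_hit_tm[OF assms, symmetric] b2_def disc_def to_enat_def hit_belief_def val_iter_evolve_tm[OF assms]
        split: option.splits)
next
  case (Suc j)
  show ?case using Suc
    by (auto simp: val_hit_tm[OF assms, symmetric] b2_def b3_def disc_def to_enat_def next_belief_def hit_belief_def
          val_iter_evolve_tm[OF assms] mult_ac
        split: option.splits)
qed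

theorem val_priority_tm:
  assumes "valid_channel K c"
  shows "val (priority_tm K \<beta> j c w) = priority_index K \<beta> j c w"
  using assms
  by (simp add: priority_tm_def priority_index_def approx_num_def approx_den_def)

lemma val_insert_tm_props:
  "mset (val (insert_tm x ys)) = add_mset x (mset ys)"
  "sorted_wrt (\<ge>) ys \<Longrightarrow> sorted_wrt (\<ge>) (val (insert_tm x ys))"
proof -
  show m: "mset (val (insert_tm x ys)) = add_mset x (mset ys)" for ys
    by (induction ys) auto
  have s: "set (val (insert_tm x ys)) = insert x (set ys)" for ys
    using m[of ys] by (metis set_mset_add_mset_insert set_mset_mset)
  show "sorted_wrt (\<ge>) ys \<Longrightarrow> sorted_wrt (\<ge>) (val (insert_tm x ys))"
    by (induction ys) (force simp: s)+
qed

lemma val_isort_tm_props: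
  "mset (val (isort_tm xs)) = mset xs" "sorted_wrt (\<ge>) (val (isort_tm xs))"
  by (induction xs) (simp_all add: val_insert_tm_props)

lemma length_isort_tm [simp]: "length (val (isort_tm xs)) = length xs"
  by (metis size_mset val_isort_tm_props(1))

lemma val_partition_tm [simp]:
  "val (partition_tm p xs) =
     (filter (\<lambda>x. p < x) xs, length (filter (\<lambda>x. x = p) xs), filter (\<lambda>x. x < p) xs)"
  by (induction xs) auto

text \<open>The element at position \<open>k\<close> in descending order, characterised by counting.\<close>

definition is_kth :: "nat \<Rightarrow> real list \<Rightarrow> real \<Rightarrow> bool" where
  "is_kth k xs v \<longleftrightarrow> length (filter (\<lambda>x. v < x) xs) \<le> k \<and> k < length (filter (\<lambda>x. v \<le> x) xs)"

lemma length_filter_le_split: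
  "length (filter (\<lambda>x. (v::real) \<le> x) xs) = length (filter (\<lambda>x. v < x) xs) + length (filter (\<lambda>x. x = v) xs)"
  by (induction xs) auto

lemma is_kth_sorted:
  assumes "sorted_wrt (\<ge>) ys" "k < length ys"
  shows "is_kth k ys (ys ! k)"
proof -
  have ord: "ys ! j \<le> ys ! i" if "i \<le> j" "j < length ys" for i j
    using assms(1) that by (cases "i = j") (auto simp: sorted_wrt_iff_nth_less)
  have "{i. i < length ys \<and> ys ! k < ys ! i} \<subseteq> {..<k}"
    using ord by (auto simp: not_less[symmetric])
  hence "card {i. i < length ys \<and> ys ! k < ys ! i} \<le> k"
    using card_mono[of "{..<k}"] by force
  moreover have "{..k} \<subseteq> {i. i < length ys \<and> ys ! k \<le> ys ! i}"
    using ord assms(2) by auto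
  hence "Suc k \<le> card {i. i < length ys \<and> ys ! k \<le> ys ! i}"
    using card_mono[of "{i. i < length ys \<and> ys ! k \<le> ys ! i}" "{..k}"] by simp
  ultimately show ?thesis by (simp add: is_kth_def length_filter_conv_card)
qed

lemma is_kth_mset: "mset xs = mset ys \<Longrightarrow> is_kth k xs v = is_kth k ys v"
  unfolding is_kth_def by (metis mset_filter size_mset)

lemma is_kth_isort:
  assumes "k < length xs"
  shows "is_kth k xs (val (nth_tm (val (isort_tm xs)) k))"
proof -
  have "is_kth k (val (isort_tm xs)) (val (isort_tm xs) ! k)"
    by (rule is_kth_sorted) (use assms val_isort_tm_props in auto)
  thus ?thesis using assms is_kth_mset[OF val_isort_tm_props(1)] by simp
qed

lemma val_kth_tm: "k < length xs \<Longrightarrow> is_kth k xs (val (kth_tm f k xs))"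
proof (induction f arbitrary: k xs)
  case 0
  thus ?case using is_kth_isort[of k xs] by simp
next
  case (Suc f)
  show ?case
  proof (cases "length xs < 25")
    case True
    thus ?thesis using is_kth_isort[of k xs] Suc.prems by simp
  next
    case False
    define p where "p = val (kth_tm f (length (val (medians_tm xs)) div 2) (val (medians_tm xs)))"
    define gs where "gs = filter (\<lambda>x. p < x) xs"
    define ls where "ls = filter (\<lambda>x. x < p) xs"
    define ne where "ne = length (filter (\<lambda>x. x = p) xs)"
    have len: "length xs = length gs + ne + length ls"
      unfolding gs_def ls_def ne_def by (induction xs) auto
    have res: "val (kth_tm (Suc f) k xs) =
        (if k < length gs then val (kth_tm f k gs)
         else if k < length gs + ne then p else val (kth_tm f (k - (length gs + ne)) ls))"
      using False by (simp add: p_def gs_def ls_def ne_def)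
    consider "k < length gs" | "length gs \<le> k" "k < length gs + ne" | "length gs + ne \<le> k"
      by linarith
    thus ?thesis
    proof cases
      case 1
      define v where "v = val (kth_tm f k gs)"
      have kg: "is_kth k gs v" unfolding v_def by (rule Suc.IH[OF 1])
      hence "filter (\<lambda>x. v \<le> x) gs \<noteq> filter (\<lambda>x. v < x) gs" by (auto simp: is_kth_def)
      hence "v \<in> set gs"
        by (metis (mono_tags, lifting) filter_cong le_less)
      hence "p < v" by (simp add: gs_def)
      hence "filter (\<lambda>x. v < x) gs = filter (\<lambda>x. v < x) xs"
        "filter (\<lambda>x. v \<le> x) gs = filter (\<lambda>x. v \<le> x) xs"
        unfolding gs_def by (auto intro!: filter_cong)
      thus ?thesis using kg 1 by (simp add: res v_def is_kth_def del: kth_tm.simps)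
    next
      case 2
      thus ?thesis
        using length_filter_le_split[of p xs]
        by (simp add: res is_kth_def gs_def ne_def del: kth_tm.simps)
    next
      case 3
      define k' where "k' = k - (length gs + ne)"
      define v where "v = val (kth_tm f k' ls)"
      have "k' < length ls" using 3 len Suc.prems by (simp add: k'_def)
      hence kl: "is_kth k' ls v" unfolding v_def by (rule Suc.IH)
      hence "filter (\<lambda>x. v \<le> x) ls \<noteq> filter (\<lambda>x. v < x) ls" by (auto simp: is_kth_def)
      hence "v \<in> set ls"
        by (metis (mono_tags, lifting) filter_cong le_less)
      hence vp: "v < p" by (simp add: ls_def)
      have "length (filter (\<lambda>x. v < x) xs) = length gs + ne + length (filter (\<lambda>x. v < x) ls)"
        "length (filter (\<lambda>x. v \<le> x) xs) = length gs + ne + length (filter (\<lambda>x. v \<le> x) ls)"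
        unfolding gs_def ne_def ls_def using vp by (induction xs) auto
      thus ?thesis using kl 3 by (auto simp: res v_def k'_def is_kth_def simp del: kth_tm.simps)
    qed
  qed
qed

lemma length_mark_tm [simp]: "length (val (mark_tm v r xs)) = length xs"
  by (induction xs arbitrary: r) auto

lemma mark_tm_above: "n < length xs \<Longrightarrow> v < xs ! n \<Longrightarrow> val (mark_tm v r xs) ! n"
  by (induction xs arbitrary: r n) (auto simp: nth_Cons' less_Suc_eq_0_disj)

lemma mark_tm_marked: "n < length xs \<Longrightarrow> val (mark_tm v r xs) ! n \<Longrightarrow> v \<le> xs ! n"
  by (induction xs arbitrary: r n) (auto simp: nth_Cons' split: if_splits)

lemma mark_tm_count:
  "length (filter id (val (mark_tm v r xs))) =
     length (filter (\<lambda>x. v < x) xs) + min r (length (filter (\<lambda>x. x = v) xs))"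
  by (induction xs arbitrary: r) auto

lemma val_select_tm:
  assumes "1 \<le> M" "M \<le> length keys"
  shows "top_selection M keys (val (select_tm M keys))"
proof -
  define v where "v = val (kth_tm (length keys) (M - 1) keys)"
  define r where "r = M - length (filter (\<lambda>x. v < x) keys)"
  have sel: "val (select_tm M keys) = val (mark_tm v r keys)"
    by (simp add: select_tm_def v_def r_def)
  have "is_kth (M - 1) keys v" unfolding v_def by (rule val_kth_tm) (use assms in auto)
  hence "length (filter id (val (mark_tm v r keys))) = M"
    unfolding mark_tm_count r_def is_kth_def length_filter_le_split using assms(1) by auto
  thus ?thesis unfolding sel top_selection_def length_filter_conv_card
    using mark_tm_above mark_tm_marked by (auto; metis le_less_linear order.trans length_mark_tm)
qed

lemma val_observe_tm:
  "length ws = length cs \<Longrightarrow> length sel = length cs \<Longrightarrow>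
     val (observe_tm e n (zip cs ws) sel) =
       (zip cs (next_beliefs cs ws sel (\<lambda>k. e (n + k))), slot_reward cs sel (\<lambda>k. e (n + k)))"
proof (induction cs arbitrary: ws sel n)
  case Nil
  thus ?case by (simp add: next_beliefs_def slot_reward_def)
next
  case (Cons c cs)
  then obtain w ws' b sel' where [simp]: "ws = w # ws'" "sel = b # sel'"
    by (metis length_Suc_conv)
  have IH: "val (observe_tm e (Suc n) (zip cs ws') sel') =
      (zip cs (next_beliefs cs ws' sel' (\<lambda>k. e (Suc n + k))), slot_reward cs sel' (\<lambda>k. e (Suc n + k)))"
    using Cons by auto
  have nb: "next_beliefs (c # cs) ws sel e' =
      (if b then post_evolve c (snd (e' 0)) w else evolve c w) # next_beliefs cs ws' sel' (\<lambda>k. e' (Suc k))" for e'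
    by (simp add: next_beliefs_def upt_conv_Cons map_Suc_upt[symmetric] comp_def del: upt_Suc)
  have sr: "slot_reward (c # cs) sel e' =
      (if b then of_bool (fst (e' 0)) * bw c else 0) + slot_reward cs sel' (\<lambda>k. e' (Suc k))" for e'
    by (simp add: slot_reward_def sum.lessThan_Suc_shift del: sum.lessThan_Suc cong: if_cong)
  show ?case unfolding nb sr using IH
    by (cases "e n") (auto split: prod.splits)
qed

theorem awi_loop_tm_correct:
  assumes "length ws = length cs" "\<forall>c\<in>set cs. valid_channel K c" "1 \<le> M" "M \<le> length cs"
  shows "length (val (awi_loop_tm K \<beta> j M env T t (zip cs ws))) = T \<and>
         awi_run K \<beta> j M cs env t ws (val (awi_loop_tm K \<beta> j M env T t (zip cs ws)))"
  using assms(1)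
proof (induction T arbitrary: t ws)
  case (Suc T)
  define keys where "keys = map2 (priority_index K \<beta> j) cs ws"
  define sel where "sel = val (select_tm M keys)"
  have keys: "map (\<lambda>x. val (case x of (c, w) \<Rightarrow> priority_tm K \<beta> j c w)) (zip cs ws) = keys"
    unfolding keys_def using assms(2) by (auto simp: val_priority_tm dest!: set_zip_leftD)
  have lk: "length keys = length cs" using Suc.prems by (simp add: keys_def)
  have top: "top_selection M keys sel" unfolding sel_def
    by (rule val_select_tm) (use assms lk in auto)
  hence ls: "length sel = length cs" using lk by (simp add: top_selection_def)
  have nb: "length (next_beliefs cs ws sel (env t)) = length cs" by (simp add: next_beliefs_def)
  have "val (awi_loop_tm K \<beta> j M env (Suc T) t (zip cs ws)) =
      (sel, slot_reward cs sel (env t)) #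
        val (awi_loop_tm K \<beta> j M env T (Suc t) (zip cs (next_beliefs cs ws sel (env t))))"
    using val_observe_tm[OF Suc.prems ls, of "env t" 0]
    by (simp add: keys sel_def[symmetric])
  thus ?case using Suc.IH[OF nb, of "Suc t"] top by (simp add: keys_def)
qed simp

theorem awi_tm_correct:
  assumes "awi_input K N M T \<beta> cs ws env"
  shows "length (val (awi_tm K \<beta> j M T cs ws env)) = T \<and>
         awi_run K \<beta> j M cs env 0 ws (val (awi_tm K \<beta> j M T cs ws env))"
  using assms awi_loop_tm_correct[of ws cs K M \<beta> j env T 0]
  by (simp add: awi_input_def awi_tm_def)

end

theory Submission
  imports Defs
begin

text \<open>Computing a priority index evaluates recursions of depth \<open>j\<close> in which every call makes \<open>K\<close>
  further ones; their call trees have \<open>1 + K + \<dots> + K ^ j\<close> nodes whose cost depends on \<open>K\<close> only. This number is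
  at most \<open>2 * K ^ j\<close> for \<open>K \<ge> 2\<close> and at most \<open>(j + 1) * K ^ j\<close> for \<open>K \<ge> 1\<close>. All other
  work in a slot is linear in the number of channels (\<open>time_kth_tm_le\<close>: median-of-medians selection
  is linear).

  For the convergence, call the difference of the values of activation and passivity the advantage of
  activation. The optimal value is a supremum of values of policies, which are affine in the belief,
  so it is convex. For convex functions, averaging over the outcomes of an experiment does not
  enlarge the range of slopes (\<open>slopes_in_experiment\<close>). Together with the Bellman equation this
  bounds how far the slopes of the continuation value spread, and if
  \<open>\<beta> * \<bar>p11 - p01\<bar> \<le> 1 / 2\<close>, which follows from \<open>\<beta> \<le> 1 / 2\<close>, the advantage
  is nondecreasing in the belief (\<open>advantage_mono\<close>).

  Now let \<open>m\<close> be a subsidy that makes both actions equally good at the belief \<open>w\<close>. By monotonicity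
  the policy with threshold \<open>w\<close> is optimal for \<open>m\<close>, and the optimal value is the fixed point of a
  contraction with factor \<open>\<beta>\<close> whose iterates are \<open>m * k_iter + a_iter\<close> (\<open>iteration_error\<close>).
  Inserting these iterates into the equation that says that the advantage vanishes gives
  \<open>m * approx_den - approx_num\<close>, which is therefore of order \<open>\<beta> ^ j\<close>
  (\<open>approx_index_equation_error\<close>). As the denominators are bounded below uniformly in the belief and
  in \<open>j\<close> (\<open>approx_den_lower_bound\<close>), the approximated indices converge to \<open>m\<close> at the rate
  \<open>\<beta> ^ j\<close>. This also shows that \<open>m\<close> is the only such subsidy, hence the Whittle index.\<close>

section \<open>The cost of a priority index\<close>

lemma time_simps [simp]:
  "time (ret x) = 1"
  "time (bind_tm m f) = time m + time (f (val m))"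
  "time (op1 g y) = time y + 1"
  "time (op2 h u v) = time u + time v + 1"
  by (simp_all add: ret_def bind_tm_def op1_def op2_def)

lemma time_sum_tm: "time (sum_tm K f) = 1 + (\<Sum>i=1..K. time (f i) + 1)"
  by (induction K) simp_all

lemma time_sum_tm_le:
  assumes "\<And>i. time (f i) \<le> B"
  shows "time (sum_tm K f) \<le> 1 + K * (B + 1)"
proof -
  have "(\<Sum>i=1..K. time (f i) + 1) \<le> (\<Sum>i=1..K. B + 1)"
    using assms by (intro sum_mono) simp
  thus ?thesis by (simp add: time_sum_tm)
qed

lemma time_map_tm_le:
  assumes "\<And>x. time (f x) \<le> B"
  shows "time (map_tm f xs) \<le> 1 + length xs * (B + 1)"
proof (induction xs)
  case (Cons x xs)
  thus ?case using assms[of x] by simp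
qed simp

lemma time_zip_tm_le: "time (zip_tm xs ys) \<le> 1 + length xs"
  by (induction xs ys rule: zip_tm.induct) simp_all

lemma time_length_tm: "time (length_tm xs) = 1 + 2 * length xs"
  by (induction xs) simp_all

lemma time_nth_tm_le: "time (nth_tm xs k) \<le> 1 + 6 * length xs"
proof (induction xs arbitrary: k)
  case (Cons x xs)
  show ?case using Cons[of "k - 1"] by simp
qed simp

lemma time_evolve_tm [simp]: "time (evolve_tm c w) = 9"
  by (simp add: evolve_tm_def)

lemma time_obs_prob_tm [simp]: "time (obs_prob_tm c i w) = 9"
  by (simp add: obs_prob_tm_def)

lemma time_post_evolve_tm [simp]: "time (post_evolve_tm c i w) = 22"
  by (simp add: post_evolve_tm_def)

lemma time_iter_evolve_tm [simp]: "time (iter_evolve_tm c l x) = 17"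
  by (simp add: iter_evolve_tm_def)

lemma time_hit_tm_le: "time (hit_tm c ws x) \<le> 40"
  by (simp add: hit_tm_def)

text \<open>An iterate of positive depth is evaluated by \<open>K\<close> recursive calls, so the call tree has \<open>geom_sum K j\<close> nodes. Keeping this sum, instead of passing
  to \<open>K ^ j\<close> at once, lets the estimates up to the final one cover \<open>K = 1\<close> as well.\<close>

definition geom_sum :: "nat \<Rightarrow> nat \<Rightarrow> nat" where
  "geom_sum K j = (\<Sum>i\<le>j. K ^ i)"

lemma geom_sum_0: "geom_sum K 0 = 1"
  by (simp add: geom_sum_def)

lemma geom_sum_Suc: "geom_sum K (Suc j) = 1 + K * geom_sum K j"
  unfolding geom_sum_def by (simp add: sum.atMost_Suc_shift sum_distrib_left del: sum.atMost_Suc)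

lemma geom_sum_ge_1: "1 \<le> geom_sum K j"
  by (cases j) (simp_all add: geom_sum_0 geom_sum_Suc)

text \<open>The last level of a tree that branches at every node holds more than half of the
  nodes. This is where branching by at least two makes the constant independent of the depth.\<close>

lemma geom_sum_le_double_power:
  assumes "2 \<le> K" shows "geom_sum K j \<le> 2 * K ^ j"
proof -
  have "geom_sum K j + 1 \<le> 2 * K ^ j"
  proof (induction j)
    case (Suc j)
    have "K * (geom_sum K j + 1) \<le> K * (2 * K ^ j)" using Suc by (rule mult_le_mono2)
    thus ?case using assms by (simp add: geom_sum_Suc algebra_simps)
  qed (simp add: geom_sum_0)
  thus ?thesis by simp
qed

lemma geom_sum_le_Suc_times_power:
  assumes "1 \<le> K" shows "geom_sum K j \<le> (j + 1) * K ^ j"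
proof -
  have "geom_sum K j \<le> (\<Sum>i\<le>j. K ^ j)"
    unfolding geom_sum_def using assms by (intro sum_mono power_increasing) auto
  thus ?thesis by simp
qed

text \<open>One call costs at most a constant plus \<open>K\<close> times a constant besides its recursive calls,
  and the recursion \<open>geom_sum K (Suc j) = 1 + K * geom_sum K j\<close> charges this to the node.
  The numerical constants here and below are generous.\<close>

lemma time_k_tm_le: "time (k_tm K \<beta> c ws j x) \<le> (100 + 100 * K) * geom_sum K j"
proof (induction j arbitrary: x)
  case 0
  show ?case using time_hit_tm_le[of c ws x]
    by (auto simp: geom_sum_0 split: option.split)
next
  case (Suc j)
  let ?B = "(100 + 100 * K) * geom_sum K j"
  have "time (sum_tm K (\<lambda>i. do {
           q \<leftarrow> obs_prob_tm c i y;
           z \<leftarrow> post_evolve_tm c i y;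
           r \<leftarrow> k_tm K \<beta> c ws j z;
           ret \<beta> \<otimes> ret b \<otimes> ret q \<otimes> ret r
         })) \<le> 1 + K * ((38 + ?B) + 1)" for b y
    by (rule time_sum_tm_le) (use Suc in simp)
  also have "1 + K * ((38 + ?B) + 1) = 1 + K * 39 + K * ?B" by (simp add: algebra_simps)
  finally have s: "time (sum_tm K (\<lambda>i. do {
           q \<leftarrow> obs_prob_tm c i y;
           z \<leftarrow> post_evolve_tm c i y;
           r \<leftarrow> k_tm K \<beta> c ws j z;
           ret \<beta> \<otimes> ret b \<otimes> ret q \<otimes> ret r
         })) \<le> 1 + K * 39 + K * ?B" for b y .
  have "time (k_tm K \<beta> c ws (Suc j) x) \<le> 100 + 39 * K + K * ?B"
  proof (cases "val (hit_tm c ws x)")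
    case None
    thus ?thesis using time_hit_tm_le[of c ws x] by simp
  next
    case (Some l)
    show ?thesis using time_hit_tm_le[of c ws x] s[of "val (iter_evolve_tm c l x)" "\<beta> ^ l"]
      by (simp add: Some)
  qed
  also have "\<dots> \<le> (100 + 100 * K) * (1 + K * geom_sum K j)"
    by (simp add: algebra_simps)
  finally show ?case by (simp only: geom_sum_Suc)
qed

lemma time_a_tm_le: "time (a_tm K \<beta> c ws j x) \<le> (100 + 100 * K) * geom_sum K j"
proof (induction j arbitrary: x)
  case 0
  show ?case using time_hit_tm_le[of c ws x]
    by (auto simp: geom_sum_0 split: option.split)
next
  case (Suc j)
  let ?B = "(100 + 100 * K) * geom_sum K j"
  have "time (sum_tm K (\<lambda>i. do {
           q \<leftarrow> obs_prob_tm c i y;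
           z \<leftarrow> post_evolve_tm c i y;
           r \<leftarrow> a_tm K \<beta> c ws j z;
           ret \<beta> \<otimes> ret b \<otimes> ret q \<otimes> ret r
         })) \<le> 1 + K * ((38 + ?B) + 1)" for b y
    by (rule time_sum_tm_le) (use Suc in simp)
  also have "1 + K * ((38 + ?B) + 1) = 1 + K * 39 + K * ?B" by (simp add: algebra_simps)
  finally have s: "time (sum_tm K (\<lambda>i. do {
           q \<leftarrow> obs_prob_tm c i y;
           z \<leftarrow> post_evolve_tm c i y;
           r \<leftarrow> a_tm K \<beta> c ws j z;
           ret \<beta> \<otimes> ret b \<otimes> ret q \<otimes> ret r
         })) \<le> 1 + K * 39 + K * ?B" for b y .
  have "time (a_tm K \<beta> c ws (Suc j) x) \<le> 100 + 39 * K + K * ?B"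
  proof (cases "val (hit_tm c ws x)")
    case None
    thus ?thesis using time_hit_tm_le[of c ws x] by simp
  next
    case (Some l)
    show ?thesis using time_hit_tm_le[of c ws x] s[of "val (iter_evolve_tm c l x)" "\<beta> ^ l"]
      by (simp add: Some)
  qed
  also have "\<dots> \<le> (100 + 100 * K) * (1 + K * geom_sum K j)"
    by (simp add: algebra_simps)
  finally show ?case by (simp only: geom_sum_Suc)
qed

lemma time_priority_tm_le:
  "time (priority_tm K \<beta> j c w) \<le> 1000 * (1 + K)\<^sup>2 * geom_sum K j"
proof -
  let ?B = "(100 + 100 * K) * geom_sum K j"
  have sa: "time (sum_tm K (\<lambda>i. do {
       q \<leftarrow> obs_prob_tm c i w; z \<leftarrow> post_evolve_tm c i w; r \<leftarrow> a_tm K \<beta> c w j z; ret q \<otimes> ret r }))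
      \<le> 1 + K * (34 + ?B + 1)"
    by (rule time_sum_tm_le) (use time_a_tm_le in simp)
  have sk: "time (sum_tm K (\<lambda>i. do {
       q \<leftarrow> obs_prob_tm c i w; z \<leftarrow> post_evolve_tm c i w; r \<leftarrow> k_tm K \<beta> c w j z; ret q \<otimes> ret r }))
      \<le> 1 + K * (34 + ?B + 1)"
    by (rule time_sum_tm_le) (use time_k_tm_le in simp)
  have "time (priority_tm K \<beta> j c w) \<le> 100 + 2 * ?B + 2 * (K * (35 + ?B))"
    using sa sk time_a_tm_le[of K \<beta> c w j "evolve c w"] time_k_tm_le[of K \<beta> c w j "evolve c w"]
    by (simp add: priority_tm_def)
  also have "\<dots> \<le> (100 + 70 * K) * geom_sum K j + 2 * ?B + 2 * (K * ?B)"
    using mult_le_mono2[OF geom_sum_ge_1[of K j], of "100 + 70 * K"] by (simp add: algebra_simps)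
  also have "\<dots> \<le> 1000 * (1 + K)\<^sup>2 * geom_sum K j"
    by (simp add: algebra_simps power2_eq_square)
  finally show ?thesis .
qed

section \<open>Selection in linear time\<close>

lemma length_insert_tm [simp]: "length (val (insert_tm x ys)) = Suc (length ys)"
  by (induction ys) simp_all

lemma time_insert_tm_le: "time (insert_tm x ys) \<le> 1 + 4 * length ys"
  by (induction ys) simp_all

lemma time_isort_tm_le: "time (isort_tm xs) \<le> 1 + length xs * (1 + 4 * length xs)"
proof (induction xs)
  case (Cons x xs)
  have "length (val (isort_tm xs)) = length xs" by simp
  thus ?case using Cons time_insert_tm_le[of x "val (isort_tm xs)"]
    by (simp add: algebra_simps)
qed simp

lemma time_partition_tm_le: "time (partition_tm p xs) \<le> 1 + 10 * length xs"
  by (induction xs) (auto simp: split_beta)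

lemma time_mark_tm_le: "time (mark_tm v r xs) \<le> 1 + 20 * length xs"
proof (induction xs arbitrary: r)
  case (Cons x xs)
  show ?case using Cons[of r] Cons[of "r - 1"] by simp
qed simp

lemma length_medians_tm: "length (val (medians_tm xs)) = length xs div 5"
  by (induction xs rule: medians_tm.induct) simp_all

lemma time_medians_tm_le: "time (medians_tm xs) \<le> 1 + 40 * length xs"
proof (induction xs rule: medians_tm.induct)
  case (1 a b c d e xs)
  have "time (isort_tm [a, b, c, d, e]) \<le> 106"
    using time_isort_tm_le[of "[a, b, c, d, e]"] by simp
  moreover have "time (nth_tm (val (isort_tm [a, b, c, d, e])) 2) \<le> 31"
    using time_nth_tm_le[of "val (isort_tm [a, b, c, d, e])" 2] by simp
  ultimately show ?case using 1
    by (simp del: isort_tm.simps nth_tm.simps)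
qed simp_all

lemma length_filter_mono:
  assumes "\<And>x. P x \<Longrightarrow> Q x"
  shows "length (filter P xs) \<le> length (filter Q xs)"
  using assms by (induction xs) auto

lemma length_filter_less_eq_split:
  "length (filter (\<lambda>x. (v::real) < x) xs) + length (filter (\<lambda>x. x \<le> v) xs) = length xs"
  by (induction xs) auto

text \<open>Three of five elements lie on either weak side of their median. Reading this off the rank
  property \<open>is_kth\<close> avoids a case analysis over the orderings of the five elements.\<close>

lemma median_of_five:
  assumes "v = val (nth_tm (val (isort_tm [a, b, c, d, e])) 2)"
  shows "v \<le> p \<Longrightarrow> 3 \<le> length (filter (\<lambda>x. x \<le> p) [a, b, c, d, e])"
    and "p \<le> v \<Longrightarrow> 3 \<le> length (filter (\<lambda>x. p \<le> x) [a, b, c, d, e])"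
proof -
  let ?xs = "[a, b, c, d, e]"
  have k: "is_kth 2 ?xs v"
    unfolding assms by (rule is_kth_isort) simp
  have gt: "length (filter (\<lambda>x. v < x) ?xs) + length (filter (\<lambda>x. x \<le> v) ?xs) = 5"
    by (subst length_filter_less_eq_split) simp
  show "3 \<le> length (filter (\<lambda>x. x \<le> p) ?xs)" if "v \<le> p"
  proof -
    have "length (filter (\<lambda>x. x \<le> v) ?xs) \<le> length (filter (\<lambda>x. x \<le> p) ?xs)"
      using that by (intro length_filter_mono) simp
    thus ?thesis using k gt unfolding is_kth_def by linarith
  qed
  show "3 \<le> length (filter (\<lambda>x. p \<le> x) ?xs)" if "p \<le> v"
  proof -
    have "length (filter (\<lambda>x. v \<le> x) ?xs) \<le> length (filter (\<lambda>x. p \<le> x) ?xs)"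
      using that by (intro length_filter_mono) simp
    thus ?thesis using k unfolding is_kth_def by linarith
  qed
qed

lemma medians_tm_count:
  "3 * length (filter (\<lambda>x. x \<le> p) (val (medians_tm xs))) \<le> length (filter (\<lambda>x. x \<le> p) xs)"
  "3 * length (filter (\<lambda>x. p \<le> x) (val (medians_tm xs))) \<le> length (filter (\<lambda>x. p \<le> x) xs)"
proof (induction xs rule: medians_tm.induct)
  case (1 a b c d e xs)
  define v where "v = val (nth_tm (val (isort_tm [a, b, c, d, e])) 2)"
  have m: "val (medians_tm (a # b # c # d # e # xs)) = v # val (medians_tm xs)"
    by (simp add: v_def)
  have split: "filter Q (a # b # c # d # e # xs) = filter Q [a, b, c, d, e] @ filter Q xs" for Q
    by simp
  {
    case 1
    show ?case using "1.IH"(1) median_of_five(1)[OF v_def, of p] unfolding m split by fastforce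
  next
    case 2
    show ?case using "1.IH"(2) median_of_five(2)[OF v_def, of p] unfolding m split by fastforce
  }
qed simp_all

text \<open>The pivot is the median of the \<open>q\<close> medians, hence about \<open>q / 2\<close> of the medians are at
  least (and about \<open>q / 2\<close> at most) the pivot, and each of them brings along three elements of its
  block. So either remaining part misses about \<open>3 q / 2\<close> elements.\<close>

lemma pivot_split:
  assumes "25 \<le> length xs"
    and p: "p = val (kth_tm f (length (val (medians_tm xs)) div 2) (val (medians_tm xs)))"
  defines "q \<equiv> length xs div 5"
  shows "2 * length (filter (\<lambda>x. p < x) xs) + 3 * q \<le> 2 * length xs"
    and "2 * length (filter (\<lambda>x. x < p) xs) + 3 * q \<le> 2 * length xs"
proof -
  define ms where "ms = val (medians_tm xs)"
  have lm: "length ms = q" by (simp add: ms_def q_def length_medians_tm)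
  have q: "5 \<le> q" using assms(1) by (simp add: q_def)
  have "is_kth (q div 2) ms p"
    unfolding p ms_def[symmetric] lm by (rule val_kth_tm) (use q lm in simp)
  hence k: "length (filter (\<lambda>x. p < x) ms) \<le> q div 2" "q div 2 < length (filter (\<lambda>x. p \<le> x) ms)"
    by (auto simp: is_kth_def)
  have "length (filter (\<lambda>x. p < x) ms) + length (filter (\<lambda>x. x \<le> p) ms) = q"
    by (simp add: length_filter_less_eq_split lm)
  moreover have "length (filter (\<lambda>x. p < x) xs) + length (filter (\<lambda>x. x \<le> p) xs) = length xs"
    by (rule length_filter_less_eq_split)
  moreover have "3 * length (filter (\<lambda>x. x \<le> p) ms) \<le> length (filter (\<lambda>x. x \<le> p) xs)"
    unfolding ms_def by (rule medians_tm_count)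
  ultimately show "2 * length (filter (\<lambda>x. p < x) xs) + 3 * q \<le> 2 * length xs"
    using k(1) by linarith
  have "length (filter (\<lambda>x. x < p) xs) + length (filter (\<lambda>x. p \<le> x) xs) = length xs"
    by (induction xs) auto
  moreover have "3 * length (filter (\<lambda>x. p \<le> x) ms) \<le> length (filter (\<lambda>x. p \<le> x) xs)"
    unfolding ms_def by (rule medians_tm_count)
  ultimately show "2 * length (filter (\<lambda>x. x < p) xs) + 3 * q \<le> 2 * length xs"
    using k(2) by linarith
qed

lemma time_small_sort:
  assumes "length xs < 25"
  shows "time (isort_tm xs) + time (nth_tm (val (isort_tm xs)) k) \<le> 2800"
proof -
  have "length xs * (1 + 4 * length xs) \<le> 24 * (1 + 4 * 24)"
    using assms by (intro mult_le_mono add_mono) auto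
  hence "time (isort_tm xs) \<le> 2400"
    by (intro order.trans[OF time_isort_tm_le]) simp
  moreover have "time (nth_tm (val (isort_tm xs)) k) \<le> 200"
    using assms by (intro order.trans[OF time_nth_tm_le]) simp
  ultimately show ?thesis by simp
qed

text \<open>The two recursive calls are on lists of lengths \<open>q\<close> and at most \<open>n - 3 q / 2\<close>, where
  \<open>q \<ge> n / 6\<close>. Together they are shorter than \<open>n\<close> by \<open>q / 2\<close>, a fixed fraction of \<open>n\<close>, and the
  linear bound for this fraction pays for the linear amount of work outside the calls. The lists
  shrink in every call, so that the fuel \<open>f\<close> suffices.\<close>

lemma time_kth_tm_le: "length xs \<le> f \<Longrightarrow> time (kth_tm f k xs) \<le> 3000 + 3000 * length xs"
proof (induction f arbitrary: k xs)
  case 0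
  thus ?case using time_small_sort[of xs k] by simp
next
  case (Suc f)
  show ?case
  proof (cases "length xs < 25")
    case True
    thus ?thesis using time_small_sort[of xs k] by (simp add: time_length_tm)
  next
    case False
    define n where "n = length xs"
    define q where "q = n div 5"
    define ms where "ms = val (medians_tm xs)"
    define p where "p = val (kth_tm f (length ms div 2) ms)"
    define gs where "gs = filter (\<lambda>x. p < x) xs"
    define ls where "ls = filter (\<lambda>x. x < p) xs"
    define ne where "ne = length (filter (\<lambda>x. x = p) xs)"
    have q: "5 \<le> q" "n \<le> 6 * q" "5 * q \<le> n" using False unfolding q_def n_def by linarith+
    have lm: "length ms = q" by (simp add: ms_def q_def n_def length_medians_tm)
    have sp: "2 * length gs + 3 * q \<le> 2 * n" "2 * length ls + 3 * q \<le> 2 * n"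
      unfolding gs_def ls_def n_def q_def using False
      by (intro pivot_split[of _ _ f]; simp add: p_def ms_def)+
    have f: "length ms \<le> f" "length gs \<le> f" "length ls \<le> f"
      using Suc.prems sp q lm by (auto simp flip: n_def)
    have rec: "time (kth_tm f k' gs) \<le> 3000 + 3000 * length gs"
      "time (kth_tm f k' ls) \<le> 3000 + 3000 * length ls"
      "time (kth_tm f k' ms) \<le> 3000 + 3000 * q" for k'
      using Suc.IH f lm by metis+
    have "time (kth_tm (Suc f) k xs) \<le>
        50 + 2 * n + time (medians_tm xs) + 2 * length ms + time (kth_tm f (length ms div 2) ms)
        + time (partition_tm p xs) + 2 * length gs
        + max (time (kth_tm f k gs)) (time (kth_tm f (k - (length gs + ne)) ls))"
      using False
      by (auto simp: time_length_tm n_def[symmetric] ms_def[symmetric] p_def[symmetric]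
          gs_def[symmetric] ls_def[symmetric] ne_def[symmetric] max_def)
    also have "\<dots> \<le> 50 + 2 * n + (1 + 40 * n) + 2 * n + (3000 + 3000 * q) + (1 + 10 * n)
        + 2 * n + (3000 + 3000 * max (length gs) (length ls))"
      using rec(1)[of k] rec(2)[of "k - (length gs + ne)"] rec(3)[of "length ms div 2"]
        time_medians_tm_le[of xs] time_partition_tm_le[of p xs] sp q lm
      unfolding n_def[symmetric] by linarith
    also have "\<dots> \<le> 3000 + 3000 * n" using sp q by linarith
    finally show ?thesis by (simp add: n_def)
  qed
qed

lemma time_select_tm_le: "time (select_tm M keys) \<le> 4000 + 4000 * length keys"
proof -
  let ?n = "length keys"
  define v where "v = val (kth_tm ?n (M - Suc 0) keys)"
  define r where "r = M - length (filter (\<lambda>x. v < x) keys)"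
  have "time (select_tm M keys) \<le> 20 + 2 * ?n + time (kth_tm ?n (M - Suc 0) keys)
      + time (partition_tm v keys) + 2 * length (filter (\<lambda>x. v < x) keys) + time (mark_tm v r keys)"
    by (simp add: select_tm_def time_length_tm v_def[symmetric] r_def[symmetric])
  moreover have "length (filter (\<lambda>x. v < x) keys) \<le> ?n" by (rule length_filter_le)
  moreover have "time (kth_tm ?n (M - Suc 0) keys) \<le> 3000 + 3000 * ?n"
    by (rule time_kth_tm_le) simp
  ultimately show ?thesis
    using time_partition_tm_le[of v keys] time_mark_tm_le[of v r keys] by linarith
qed

section \<open>The cost of the algorithm\<close>

lemma time_observe_tm_le: "time (observe_tm e n xs bs) \<le> 1 + 60 * length xs"
proof (induction xs arbitrary: n bs)
  case (Cons x xs)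
  obtain c w where x: "x = (c, w)" by (cases x)
  show ?case
  proof (cases bs)
    case (Cons b bs')
    thus ?thesis using Cons.IH[of "Suc n" bs'] by (simp add: x split_beta)
  qed simp
qed simp

lemma length_observe_tm_le: "length (fst (val (observe_tm e n xs bs))) \<le> length xs"
proof (induction xs arbitrary: n bs)
  case (Cons x xs)
  obtain c w where x: "x = (c, w)" by (cases x)
  show ?case
  proof (cases bs)
    case (Cons b bs')
    thus ?thesis using Cons.IH[of "Suc n" bs'] by (simp add: x split_beta)
  qed simp
qed simp

lemma time_awi_loop_tm_le:
  assumes "length xs \<le> N"
  shows "time (awi_loop_tm K \<beta> j M env T t xs)
           \<le> 1 + T * (5000 + N * (5000 + 1000 * (1 + K)\<^sup>2 * geom_sum K j))"
  using assms
proof (induction T arbitrary: t xs)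
  case (Suc T)
  let ?P = "1000 * (1 + K)\<^sup>2 * geom_sum K j"
  define keys where "keys = map (\<lambda>x. val (case x of (c, w) \<Rightarrow> priority_tm K \<beta> j c w)) xs"
  define sel where "sel = val (select_tm M keys)"
  define ys where "ys = fst (val (observe_tm (env t) 0 xs sel))"
  have ys: "length ys \<le> N"
    using length_observe_tm_le[of "env t" 0 xs sel] Suc.prems by (simp add: ys_def)
  have m: "time (map_tm (\<lambda>(c, w). priority_tm K \<beta> j c w) xs) \<le> 1 + length xs * (?P + 1)"
    by (rule time_map_tm_le) (use time_priority_tm_le in \<open>simp add: split_beta\<close>)
  have "time (awi_loop_tm K \<beta> j M env (Suc T) t xs) \<le>
      time (map_tm (\<lambda>(c, w). priority_tm K \<beta> j c w) xs) + time (select_tm M keys)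
      + time (observe_tm (env t) 0 xs sel) + 4 + time (awi_loop_tm K \<beta> j M env T (Suc t) ys)"
    by (simp add: split_beta keys_def sel_def ys_def)
  also have "\<dots> \<le> (1 + length xs * (?P + 1)) + (4000 + 4000 * length xs) + (1 + 60 * length xs) + 4
      + (1 + T * (5000 + N * (5000 + ?P)))"
    using m time_select_tm_le[of M keys] time_observe_tm_le[of "env t" 0 xs sel]
      Suc.IH[OF ys, of "Suc t"]
    by (simp add: keys_def)
  also have "\<dots> \<le> 1 + (5000 + length xs * (5000 + ?P)) + T * (5000 + N * (5000 + ?P))"
    by (simp add: algebra_simps)
  also have "\<dots> \<le> 1 + (5000 + N * (5000 + ?P)) + T * (5000 + N * (5000 + ?P))"
    using Suc.prems by (intro add_mono mult_le_mono) auto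
  also have "\<dots> = 1 + Suc T * (5000 + N * (5000 + ?P))" by simp
  finally show ?case .
qed simp

lemma time_awi_tm_le:
  assumes "awi_input K N M T \<beta> cs ws env"
  shows "time (awi_tm K \<beta> j M T cs ws env) \<le> (20000 + 1000 * (1 + K)\<^sup>2) * (N * T * geom_sum K j)"
proof -
  let ?P = "1000 * (1 + K)\<^sup>2" and ?S = "geom_sum K j"
  have len: "length cs = N" and NT: "1 \<le> N" "1 \<le> T" using assms by (auto simp: awi_input_def)
  have S: "1 \<le> ?S" by (rule geom_sum_ge_1)
  have "time (awi_tm K \<beta> j M T cs ws env) \<le> (1 + N) + (1 + T * (5000 + N * (5000 + ?P * ?S)))"
    unfolding awi_tm_def using time_zip_tm_le[of cs ws] len
      time_awi_loop_tm_le[of "zip cs ws" N K \<beta> j M env T 0]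
    by simp
  also have "\<dots> = 2 + N + 5000 * T + 5000 * (N * T) + ?P * (N * T * ?S)" by (simp add: algebra_simps)
  also have "\<dots> \<le> 20000 * (N * T) + ?P * (N * T * ?S)"
  proof -
    have "N * 1 \<le> N * T" "1 * T \<le> N * T" "1 * 1 \<le> N * T" using NT by (intro mult_le_mono; simp)+
    thus ?thesis by linarith
  qed
  also have "\<dots> \<le> 20000 * (N * T * ?S) + ?P * (N * T * ?S)"
    using S by (intro add_mono mult_le_mono2 order.refl) simp
  finally show ?thesis by (simp add: algebra_simps)
qed

theorem awi_complexity:
  fixes K :: nat
  assumes "1 \<le> K"
  shows "2 \<le> K \<Longrightarrow> \<exists>C::real. \<forall>j N M T \<beta> cs ws env. awi_input K N M T \<beta> cs ws env \<longrightarrow>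
             real (time (awi_tm K \<beta> j M T cs ws env)) \<le> C * (real N * real T * real K ^ j)"
    and "\<exists>C::real. \<forall>N M T \<beta> cs ws env. awi_input K N M T \<beta> cs ws env \<longrightarrow>
             real (time (awi_tm K \<beta> j M T cs ws env)) \<le> C * (real N * real T * real K ^ j)"
proof -
  define B where "B = 20000 + 1000 * (1 + K)\<^sup>2"
  have bound: "real (time (awi_tm K \<beta> j M T cs ws env)) \<le> real (B * A) * (real N * real T * real K ^ j)"
    if "awi_input K N M T \<beta> cs ws env" "geom_sum K j \<le> A * K ^ j" for j N M T \<beta> cs ws env A
  proof -
    have "time (awi_tm K \<beta> j M T cs ws env) \<le> B * (N * T * (A * K ^ j))"
      using time_awi_tm_le[OF that(1), of j] that(2) unfolding B_def
      by (meson le_trans mult_le_mono2)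
    also have "\<dots> = (B * A) * (N * T * K ^ j)" by (simp add: algebra_simps)
    finally have "real (time (awi_tm K \<beta> j M T cs ws env)) \<le> real ((B * A) * (N * T * K ^ j))"
      by (rule of_nat_mono)
    thus ?thesis by simp
  qed
  show "\<exists>C::real. \<forall>j N M T \<beta> cs ws env. awi_input K N M T \<beta> cs ws env \<longrightarrow>
             real (time (awi_tm K \<beta> j M T cs ws env)) \<le> C * (real N * real T * real K ^ j)" if "2 \<le> K"
    using bound geom_sum_le_double_power[OF that] by blast
  show "\<exists>C::real. \<forall>N M T \<beta> cs ws env. awi_input K N M T \<beta> cs ws env \<longrightarrow>
             real (time (awi_tm K \<beta> j M T cs ws env)) \<le> C * (real N * real T * real K ^ j)"
    using bound geom_sum_le_Suc_times_power[OF assms] by blast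
qed

section \<open>Bayesian experiments do not widen the range of slopes\<close>

definition slopes_in :: "(real \<Rightarrow> real) \<Rightarrow> real \<Rightarrow> real \<Rightarrow> bool" where
  "slopes_in G l u \<longleftrightarrow>
     (\<forall>x y. 0 \<le> x \<longrightarrow> x \<le> y \<longrightarrow> y \<le> 1 \<longrightarrow> l * (y - x) \<le> G y - G x \<and> G y - G x \<le> u * (y - x))"

lemma slopes_inD:
  assumes "slopes_in G l u" "0 \<le> x" "x \<le> y" "y \<le> 1"
  shows "l * (y - x) \<le> G y - G x" "G y - G x \<le> u * (y - x)"
  using assms by (auto simp: slopes_in_def)

text \<open>The perspective function of convex analysis, which is the extension of \<open>G\<close> from
  beliefs to unnormalised pairs of weights (of state 1 and of state 0) that is homogeneous of
  degree one. If \<open>a\<close> and \<open>b\<close> are the joint probabilities of an observation with the two states, its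
  value is the probability of the observation times \<open>G\<close> of the posterior belief.\<close>

definition perspective :: "(real \<Rightarrow> real) \<Rightarrow> real \<Rightarrow> real \<Rightarrow> real" where
  "perspective G a b = (a + b) * G (a / (a + b))"

text \<open>A homogeneous convex function is sublinear.\<close>

lemma perspective_subadditive:
  assumes G: "convex_on {0..1} G" and nn: "0 \<le> a" "0 \<le> b" "0 \<le> a'" "0 \<le> b'"
  shows "perspective G (a + a') (b + b') \<le> perspective G a b + perspective G a' b'"
proof (cases "a + b = 0 \<or> a' + b' = 0")
  case True
  hence "a = 0 \<and> b = 0 \<or> a' = 0 \<and> b' = 0" using nn by linarith
  thus ?thesis by (auto simp: perspective_def)
next
  case False
  define s where "s = a + b"
  define s' where "s' = a' + b'"
  have s: "0 < s" "0 < s'" using False nn by (auto simp: s_def s'_def)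
  have mean: "(s / (s + s')) * (a / s) + (s' / (s + s')) * (a' / s') = (a + a') / (s + s')"
    using s by (simp add: add_divide_distrib)
  have "G ((1 - s' / (s + s')) *\<^sub>R (a / s) + (s' / (s + s')) *\<^sub>R (a' / s'))
      \<le> (1 - s' / (s + s')) * G (a / s) + (s' / (s + s')) * G (a' / s')"
    using s nn by (intro convex_onD[OF G]) (auto simp: s_def s'_def)
  moreover have "1 - s' / (s + s') = s / (s + s')" using s by (simp add: field_simps)
  ultimately have "G ((a + a') / (s + s')) \<le> (s / (s + s')) * G (a / s) + (s' / (s + s')) * G (a' / s')"
    using mean by simp
  hence "(s + s') * G ((a + a') / (s + s')) \<le>
      (s + s') * ((s / (s + s')) * G (a / s) + (s' / (s + s')) * G (a' / s'))"
    using s by (intro mult_left_mono) auto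
  also have "\<dots> = s * G (a / s) + s' * G (a' / s')"
    using s by (simp add: distrib_left)
  finally show ?thesis
    by (simp add: perspective_def s_def s'_def algebra_simps)
qed

text \<open>Adding weight to state 0 moves the belief from \<open>a / (a + b)\<close> down to some \<open>z\<close>. Both this
  move and the distance from \<open>z\<close> up to the belief 1 cost at most \<open>u\<close> per unit, and the weighted
  total of these distances is exactly the weight \<open>e\<close> that was added.\<close>

lemma perspective_add_right:
  assumes G: "slopes_in G l u" and nn: "0 \<le> a" "0 \<le> b" "0 \<le> e"
  shows "perspective G a b + e * (G 1 - u) \<le> perspective G a (b + e)"
proof (cases "a + b = 0")
  case True
  hence "a = 0" "b = 0" using nn by linarith+
  thus ?thesis using slopes_inD(2)[OF G, of 0 1] nn
    by (auto simp: perspective_def intro!: mult_left_mono)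
next
  case False
  define s where "s = a + b"
  define z where "z = a / (s + e)"
  have s: "0 < s" using False nn by (auto simp: s_def)
  have z: "0 \<le> z" "z \<le> a / s" "a / s \<le> 1" "(s + e) * z = a"
    using s nn by (auto simp: z_def s_def field_simps)
  have "s * (G (a / s) - G z) \<le> s * (u * (a / s - z))"
    using slopes_inD(2)[OF G, of z "a / s"] z s by (intro mult_left_mono) auto
  moreover have "e * (G 1 - G z) \<le> e * (u * (1 - z))"
    using slopes_inD(2)[OF G, of z 1] z nn by (intro mult_left_mono) auto
  moreover have "s * (u * (a / s - z)) + e * (u * (1 - z)) = u * (a + e - (s + e) * z)"
    using s by (simp add: algebra_simps)
  ultimately have "s * (G (a / s) - G z) + e * (G 1 - G z) \<le> u * e"
    using z by simp
  thus ?thesis by (simp add: perspective_def s_def z_def algebra_simps)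
qed

lemma perspective_add_left:
  assumes G: "slopes_in G l u" and nn: "0 \<le> a" "0 \<le> b" "0 \<le> e"
  shows "perspective G a b + e * (G 0 + l) \<le> perspective G (a + e) b"
proof (cases "a + b = 0")
  case True
  hence "a = 0" "b = 0" using nn by linarith+
  thus ?thesis using slopes_inD(1)[OF G, of 0 1] nn
    by (auto simp: perspective_def intro!: mult_left_mono)
next
  case False
  define s where "s = a + b"
  define z where "z = (a + e) / (s + e)"
  have s: "0 < s" using False nn by (auto simp: s_def)
  have z: "0 \<le> a / s" "a / s \<le> z" "z \<le> 1" "(s + e) * z = a + e"
    using s nn by (auto simp: z_def s_def field_simps)
  have "s * (l * (z - a / s)) \<le> s * (G z - G (a / s))"
    using slopes_inD(1)[OF G, of "a / s" z] z s by (intro mult_left_mono) auto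
  moreover have "e * (l * (z - 0)) \<le> e * (G z - G 0)"
    using slopes_inD(1)[OF G, of 0 z] z nn by (intro mult_left_mono) auto
  moreover have "s * (l * (z - a / s)) + e * (l * (z - 0)) = l * ((s + e) * z - a)"
    using s by (simp add: algebra_simps)
  ultimately have "l * e \<le> s * (G z - G (a / s)) + e * (G z - G 0)"
    using z by simp
  thus ?thesis by (simp add: perspective_def s_def z_def algebra_simps)
qed

text \<open>Let \<open>p\<close> and \<open>q\<close> be the distributions of an observation in the states 1 and 0. Increasing
  the prior belief by \<open>d\<close> adds \<open>d * p i\<close> to the weight of state 1 and removes \<open>d * q i\<close> from that of
  state 0. By sublinearity the added weight is worth at most \<open>d * p i * G 1\<close>, and by
  \<open>perspective_add_right\<close> the removed weight is worth at least \<open>d * q i * (G 1 - u)\<close>. In the sum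
  over all observations the multiples of \<open>G 1\<close> cancel, because \<open>p\<close> and \<open>q\<close> have the same total, and
  \<open>d * u\<close> is left. The lower bound is symmetric.\<close>

lemma slopes_in_experiment:
  fixes p q :: "'i \<Rightarrow> real"
  assumes G: "convex_on {0..1} G" "slopes_in G l u"
    and p: "\<And>i. i \<in> I \<Longrightarrow> 0 \<le> p i" "(\<Sum>i\<in>I. p i) = 1"
    and q: "\<And>i. i \<in> I \<Longrightarrow> 0 \<le> q i" "(\<Sum>i\<in>I. q i) = 1"
  shows "slopes_in (\<lambda>x. \<Sum>i\<in>I. perspective G (p i * x) (q i * (1 - x))) l u"
  unfolding slopes_in_def
proof (intro allI impI conjI)
  fix x y :: real assume xy: "0 \<le> x" "x \<le> y" "y \<le> 1"
  let ?F = "\<lambda>i x. perspective G (p i * x) (q i * (1 - x))"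
  define d where "d = y - x"
  have d: "0 \<le> d" using xy by (simp add: d_def)
  have up: "?F i y \<le> ?F i x + (p i * (d * G 1) - q i * (d * (G 1 - u)))" if i: "i \<in> I" for i
  proof -
    have "?F i y + q i * d * (G 1 - u) \<le> perspective G (p i * y) (q i * (1 - y) + q i * d)"
      using i xy d p q by (intro perspective_add_right[OF G(2)]) auto
    also have "\<dots> = perspective G (p i * x + p i * d) (q i * (1 - x) + 0)"
      by (simp add: d_def algebra_simps)
    also have "\<dots> \<le> ?F i x + perspective G (p i * d) 0"
      using i xy d p q by (intro perspective_subadditive[OF G(1)]) auto
    also have "perspective G (p i * d) 0 = p i * (d * G 1)"
      by (simp add: perspective_def)
    finally show ?thesis by (simp add: algebra_simps)
  qed
  have lo: "?F i x \<le> ?F i y + (q i * (d * G 0) - p i * (d * (G 0 + l)))" if i: "i \<in> I" for i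
  proof -
    have "?F i x + p i * d * (G 0 + l) \<le> perspective G (p i * x + p i * d) (q i * (1 - x))"
      using i xy d p q by (intro perspective_add_left[OF G(2)]) auto
    also have "\<dots> = perspective G (p i * y + 0) (q i * (1 - y) + q i * d)"
      by (simp add: d_def algebra_simps)
    also have "\<dots> \<le> ?F i y + perspective G 0 (q i * d)"
      using i xy d p q by (intro perspective_subadditive[OF G(1)]) auto
    also have "perspective G 0 (q i * d) = q i * (d * G 0)"
      by (simp add: perspective_def)
    finally show ?thesis by (simp add: algebra_simps)
  qed
  have "(\<Sum>i\<in>I. ?F i y) \<le> (\<Sum>i\<in>I. ?F i x) + ((\<Sum>i\<in>I. p i) * (d * G 1) - (\<Sum>i\<in>I. q i) * (d * (G 1 - u)))"
    unfolding sum_distrib_right sum_subtractf[symmetric] sum.distrib[symmetric]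
    using up by (rule sum_mono)
  thus "(\<Sum>i\<in>I. ?F i y) - (\<Sum>i\<in>I. ?F i x) \<le> u * (y - x)"
    by (simp add: p q d_def[symmetric] algebra_simps)
  have "(\<Sum>i\<in>I. ?F i x) \<le> (\<Sum>i\<in>I. ?F i y) + ((\<Sum>i\<in>I. q i) * (d * G 0) - (\<Sum>i\<in>I. p i) * (d * (G 0 + l)))"
    unfolding sum_distrib_right sum_subtractf[symmetric] sum.distrib[symmetric]
    using lo by (rule sum_mono)
  thus "l * (y - x) \<le> (\<Sum>i\<in>I. ?F i y) - (\<Sum>i\<in>I. ?F i x)"
    by (simp add: p q d_def[symmetric] algebra_simps)
qed

section \<open>The value of a policy\<close>

definition next_active :: "channel \<Rightarrow> bool \<Rightarrow> real" where
  "next_active c s = (if s then p11 c else p01 c)"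

primrec process_from :: "channel \<Rightarrow> policy \<Rightarrow> bool \<Rightarrow> nat \<Rightarrow> (nat option list \<times> bool) pmf" where
  "process_from c \<pi> s 0 = return_pmf ([], s)"
| "process_from c \<pi> s (Suc t) = do {
     (h, s) \<leftarrow> process_from c \<pi> s t;
     y \<leftarrow> (if \<pi> h then map_pmf Some (emit c s) else return_pmf None);
     s' \<leftarrow> bernoulli_pmf (next_active c s);
     return_pmf (y # h, s')
   }"

lemma process_eq_process_from:
  "process c \<pi> w t = bind_pmf (bernoulli_pmf w) (\<lambda>s. process_from c \<pi> s t)"
proof (induction t)
  case 0
  show ?case by (simp add: map_pmf_def)
next
  case (Suc t)
  show ?case by (simp add: Suc bind_assoc_pmf next_active_def)
qed

definition continue :: "policy \<Rightarrow> nat option \<Rightarrow> policy" where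
  "continue \<pi> y = (\<lambda>h. \<pi> (h @ [y]))"

text \<open>The process is defined by its last step, while dynamic programming needs its first one.
  Since histories list the latest slot first, the first outcome is the last entry.\<close>

lemma process_from_Suc_first:
  "process_from c \<pi> s (Suc t) = do {
     y \<leftarrow> (if \<pi> [] then map_pmf Some (emit c s) else return_pmf None);
     s' \<leftarrow> bernoulli_pmf (next_active c s);
     (h, s'') \<leftarrow> process_from c (continue \<pi> y) s' t;
     return_pmf (h @ [y], s'')
   }"
proof (induction t)
  case 0
  show ?case by (simp add: bind_return_pmf)
next
  case (Suc t)
  have "process_from c \<pi> s (Suc (Suc t)) = do {
     (h, s) \<leftarrow> process_from c \<pi> s (Suc t);
     y \<leftarrow> (if \<pi> h then map_pmf Some (emit c s) else return_pmf None);
     s' \<leftarrow> bernoulli_pmf (next_active c s);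
     return_pmf (y # h, s')
   }" by (rule process_from.simps)
  also have "\<dots> = do {
     y \<leftarrow> (if \<pi> [] then map_pmf Some (emit c s) else return_pmf None);
     s' \<leftarrow> bernoulli_pmf (next_active c s);
     (h, s'') \<leftarrow> process_from c (continue \<pi> y) s' (Suc t);
     return_pmf (h @ [y], s'')
   }"
    unfolding Suc.IH
    by (simp add: bind_assoc_pmf split_beta bind_return_pmf continue_def cong: if_cong)
  finally show ?case .
qed

definition exp_reward :: "real \<Rightarrow> channel \<Rightarrow> nat \<Rightarrow> policy \<Rightarrow> bool \<Rightarrow> real" where
  "exp_reward m c t \<pi> s =
     measure_pmf.expectation (process_from c \<pi> s t) (\<lambda>(h, s). if \<pi> h then of_bool s else m)"

locale single_channel =
  fixes K :: nat and c :: channel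
  assumes valid: "valid_channel K c"
begin

lemma transition_probs: "0 < p01 c" "p01 c < 1" "0 < p11 c" "p11 c < 1" "p01 c \<noteq> p11 c"
  using valid by (auto simp: valid_channel_def)

lemma next_active_range: "0 \<le> next_active c s" "next_active c s \<le> 1"
  using transition_probs by (auto simp: next_active_def)

lemma emit_support: "set_pmf (emit c s) \<subseteq> {1..K}"
  using valid by (auto simp: valid_channel_def)

lemma pobs_nonneg: "0 \<le> pobs c i s"
  by (simp add: pobs_def)

lemma sum_pobs: "(\<Sum>i=1..K. pobs c i s) = 1"
  unfolding pobs_def by (rule sum_pmf_eq_1) (use emit_support in auto)

lemma finite_emit: "finite (set_pmf (emit c s))"
  using emit_support finite_subset by blast

lemma finite_process_from: "finite (set_pmf (process_from c \<pi> s t))"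
proof (induction t)
  case (Suc t)
  thus ?case by (auto simp: split_beta finite_emit intro!: finite_UN_I)
qed simp

definition step_mean :: "bool \<Rightarrow> (bool \<Rightarrow> real) \<Rightarrow> real" where
  "step_mean s g = next_active c s * g True + (1 - next_active c s) * g False"

lemma expectation_step:
  assumes "\<And>s'. finite (set_pmf (f s'))"
  shows "measure_pmf.expectation (bind_pmf (bernoulli_pmf (next_active c s)) f) h
           = step_mean s (\<lambda>s'. measure_pmf.expectation (f s') h)"
  by (subst pmf_expectation_bind[where A = UNIV])
    (use assms next_active_range[of s] in \<open>auto simp: UNIV_bool step_mean_def\<close>)

lemma exp_reward_0: "exp_reward m c 0 \<pi> s = (if \<pi> [] then of_bool s else m)"
  by (simp add: exp_reward_def)

lemma exp_reward_Suc:
  "exp_reward m c (Suc t) \<pi> s =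
     (if \<pi> [] then \<Sum>i=1..K. pobs c i s * step_mean s (exp_reward m c t (continue \<pi> (Some i)))
      else step_mean s (exp_reward m c t (continue \<pi> None)))"
proof -
  let ?r = "\<lambda>(h, s). if \<pi> h then of_bool s else m"
  define rest where "rest y = bind_pmf (bernoulli_pmf (next_active c s))
     (\<lambda>s'. bind_pmf (process_from c (continue \<pi> y) s' t) (\<lambda>(h, s''). return_pmf (h @ [y], s'')))" for y
  have fin: "finite (set_pmf (bind_pmf (process_from c (continue \<pi> y) s' t)
      (\<lambda>(h, s''). return_pmf (h @ [y], s''))))" for y s'
    by (auto simp: split_beta finite_process_from)
  have map: "bind_pmf (process_from c (continue \<pi> y) s' t) (\<lambda>(h, s''). return_pmf (h @ [y], s''))
      = map_pmf (\<lambda>(h, s''). (h @ [y], s'')) (process_from c (continue \<pi> y) s' t)" for y s'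
    by (auto simp: map_pmf_def intro!: bind_pmf_cong)
  have rest: "measure_pmf.expectation (rest y) ?r = step_mean s (exp_reward m c t (continue \<pi> y))" for y
    unfolding rest_def expectation_step[OF fin] unfolding map
    by (simp add: step_mean_def exp_reward_def case_prod_unfold continue_def cong: if_cong)
  have frest: "finite (set_pmf (rest y))" for y
    unfolding rest_def using fin by auto
  show ?thesis
  proof (cases "\<pi> []")
    case True
    have "exp_reward m c (Suc t) \<pi> s = measure_pmf.expectation (bind_pmf (emit c s) (\<lambda>i. rest (Some i))) ?r"
      unfolding exp_reward_def process_from_Suc_first rest_def using True by (simp add: bind_map_pmf)
    also have "\<dots> = (\<Sum>i=1..K. pobs c i s * measure_pmf.expectation (rest (Some i)) ?r)"
      by (subst pmf_expectation_bind[where A = "{1..K}"])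
        (use emit_support frest in \<open>auto simp: pobs_def\<close>)
    finally show ?thesis using True by (simp add: rest)
  next
    case False
    have "exp_reward m c (Suc t) \<pi> s = measure_pmf.expectation (rest None) ?r"
      unfolding exp_reward_def process_from_Suc_first rest_def using False by (simp add: bind_return_pmf)
    thus ?thesis using False by (simp add: rest)
  qed
qed

lemma integrable_process_from: "integrable (measure_pmf (process_from c \<pi> s t)) (f :: _ \<Rightarrow> real)"
  by (intro integrable_measure_pmf_finite finite_process_from)

text \<open>Serves to compare two subsidies, which change the reward of a slot by at most their
  distance.\<close>

lemma exp_reward_le_shift:
  assumes "\<And>(h::nat option list) s. (if \<pi> h then of_bool s else m) \<le> (if \<pi> h then of_bool s else m') + a"
  shows "exp_reward m c t \<pi> s \<le> exp_reward m' c t \<pi> s + a"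
proof -
  have "exp_reward m c t \<pi> s \<le> measure_pmf.expectation (process_from c \<pi> s t)
      (\<lambda>(h, s). (if \<pi> h then of_bool s else m') + a)"
    unfolding exp_reward_def using assms
    by (intro integral_mono integrable_process_from) (auto simp: split_beta)
  also have "\<dots> = exp_reward m' c t \<pi> s + a"
    unfolding exp_reward_def split_beta
    by (subst Bochner_Integration.integral_add) (auto intro!: integrable_process_from)
  finally show ?thesis .
qed

lemma exp_value_bounds:
  shows "(\<And>h s. (if \<pi> h then of_bool s else m) \<le> R) \<Longrightarrow> exp_reward m c t \<pi> s \<le> R"
    and "(\<And>h s. R \<le> (if \<pi> h then of_bool s else m)) \<Longrightarrow> R \<le> exp_reward m c t \<pi> s"
proof -
  have const: "measure_pmf.expectation (process_from c \<pi> s t) (\<lambda>_. R) = R" by simp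
  show "exp_reward m c t \<pi> s \<le> R" if "\<And>h s. (if \<pi> h then of_bool s else m) \<le> R"
    unfolding exp_reward_def using that
    by (subst const[symmetric]) (intro integral_mono integrable_process_from, auto simp: split_beta)
  show "R \<le> exp_reward m c t \<pi> s" if "\<And>h s. R \<le> (if \<pi> h then of_bool s else m)"
    unfolding exp_reward_def using that
    by (subst const[symmetric]) (intro integral_mono integrable_process_from, auto simp: split_beta)
qed

lemma abs_exp_reward_le: "\<bar>exp_reward m c t \<pi> s\<bar> \<le> max 1 \<bar>m\<bar>"
proof -
  have "exp_reward m c t \<pi> s \<le> max 1 \<bar>m\<bar>" by (rule exp_value_bounds) auto
  moreover have "- max 1 \<bar>m\<bar> \<le> exp_reward m c t \<pi> s" by (rule exp_value_bounds) auto
  ultimately show ?thesis by simp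
qed

lemma expectation_process:
  assumes "0 \<le> w" "w \<le> 1"
  shows "measure_pmf.expectation (process c \<pi> w t) (\<lambda>(h, s). if \<pi> h then of_bool s else m)
           = w * exp_reward m c t \<pi> True + (1 - w) * exp_reward m c t \<pi> False"
  unfolding process_eq_process_from
  by (subst pmf_expectation_bind[where A = UNIV])
    (use assms finite_process_from in \<open>auto simp: UNIV_bool exp_reward_def\<close>)

lemma evolve_eq: "evolve c x = p01 c + (p11 c - p01 c) * x"
  by (simp add: evolve_def algebra_simps)

lemma evolve_range:
  assumes "0 \<le> w" "w \<le> 1" shows "0 \<le> evolve c w" "evolve c w \<le> 1"
proof -
  show "0 \<le> evolve c w" using assms transition_probs by (simp add: evolve_def)
  have "p11 c * w + p01 c * (1 - w) \<le> 1 * w + 1 * (1 - w)"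
    using assms transition_probs by (intro add_mono mult_right_mono) auto
  thus "evolve c w \<le> 1" by (simp add: evolve_def)
qed

lemma obs_prob_nonneg: "0 \<le> w \<Longrightarrow> w \<le> 1 \<Longrightarrow> 0 \<le> obs_prob c i w"
  by (simp add: obs_prob_def pobs_nonneg)

lemma sum_obs_prob: "(\<Sum>i=1..K. obs_prob c i w) = 1"
  unfolding obs_prob_def sum.distrib sum_distrib_right[symmetric] by (simp only: sum_pobs) simp

lemma posterior_range:
  assumes "0 \<le> w" "w \<le> 1" shows "0 \<le> posterior c i w" "posterior c i w \<le> 1"
  using assms pobs_nonneg[of i True] pobs_nonneg[of i False]
  by (auto simp: posterior_def obs_prob_def divide_le_eq_1 intro!: divide_nonneg_nonneg)
    (smt (verit) mult_nonneg_nonneg)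

lemma post_evolve_range:
  assumes "0 \<le> w" "w \<le> 1" shows "0 \<le> post_evolve c i w" "post_evolve c i w \<le> 1"
  using assms by (auto simp: post_evolve_def posterior_range evolve_range)

text \<open>Stated as products, Bayes' rule also covers observations of probability zero, whose
  posterior belief is the default value 0.\<close>

lemma bayes:
  assumes "0 \<le> w" "w \<le> 1"
  shows "obs_prob c i w * posterior c i w = pobs c i True * w"
    and "obs_prob c i w * (1 - posterior c i w) = pobs c i False * (1 - w)"
proof -
  show *: "obs_prob c i w * posterior c i w = pobs c i True * w"
  proof (cases "obs_prob c i w = 0")
    case True
    have "0 \<le> pobs c i True * w" "0 \<le> pobs c i False * (1 - w)"
      using assms pobs_nonneg by auto
    hence "pobs c i True * w = 0" using True unfolding obs_prob_def by linarith
    thus ?thesis using True by simp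
  qed (simp add: posterior_def)
  show "obs_prob c i w * (1 - posterior c i w) = pobs c i False * (1 - w)"
    using * by (simp add: right_diff_distrib obs_prob_def)
qed

end

locale discounted_channel = single_channel +
  fixes \<beta> :: real
  assumes beta: "0 < \<beta>" "\<beta> < 1"
begin

definition state_value :: "real \<Rightarrow> policy \<Rightarrow> bool \<Rightarrow> real" where
  "state_value m \<pi> s = (\<Sum>t. \<beta> ^ t * exp_reward m c t \<pi> s)"

lemma summable_geometric_bounded:
  assumes "\<And>t. \<bar>f t\<bar> \<le> R" shows "summable (\<lambda>t. \<beta> ^ t * f t)"
proof (rule summable_comparison_test')
  show "summable (\<lambda>t. \<beta> ^ t * R)" using beta by (intro summable_mult2 summable_geometric) auto
  show "norm (\<beta> ^ t * f t) \<le> \<beta> ^ t * R" for t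
    using assms[of t] beta by (auto simp: abs_mult intro!: mult_left_mono)
qed

lemma summable_exp_reward: "summable (\<lambda>t. \<beta> ^ t * exp_reward m c t \<pi> s)"
  by (rule summable_geometric_bounded) (rule abs_exp_reward_le)

lemma suminf_geometric_const: "(\<Sum>t. \<beta> ^ t * a) = a / (1 - \<beta>)"
  using beta by (simp add: suminf_mult2[symmetric] summable_geometric suminf_geometric)

text \<open>The initial belief only mixes the two initial states, so the value of a fixed policy is
  affine in it. This is the source of the convexity of the optimal value.\<close>

lemma policy_value_eq:
  assumes "0 \<le> w" "w \<le> 1"
  shows "policy_value \<beta> m c \<pi> w = w * state_value m \<pi> True + (1 - w) * state_value m \<pi> False"
proof -
  have "policy_value \<beta> m c \<pi> w = (\<Sum>t. w * (\<beta> ^ t * exp_reward m c t \<pi> True)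
      + (1 - w) * (\<beta> ^ t * exp_reward m c t \<pi> False))"
    unfolding policy_value_def expectation_process[OF assms] by (simp add: algebra_simps)
  also have "\<dots> = w * state_value m \<pi> True + (1 - w) * state_value m \<pi> False"
    unfolding state_value_def
    by (subst suminf_add[symmetric]) (auto intro!: summable_mult summable_exp_reward simp: suminf_mult summable_exp_reward)
  finally show ?thesis .
qed

lemma state_value_le_shift:
  assumes "\<And>t. exp_reward m c t \<pi> s \<le> exp_reward m' c t \<pi> s + a"
  shows "state_value m \<pi> s \<le> state_value m' \<pi> s + a / (1 - \<beta>)"
proof -
  have "state_value m \<pi> s \<le> (\<Sum>t. \<beta> ^ t * exp_reward m' c t \<pi> s + \<beta> ^ t * a)"
    unfolding state_value_def using beta assms
    by (intro suminf_le summable_add summable_exp_reward summable_mult2 summable_geometric)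
      (auto simp flip: distrib_left)
  also have "\<dots> = state_value m' \<pi> s + a / (1 - \<beta>)"
    unfolding state_value_def using beta
    by (subst suminf_add[symmetric])
      (auto intro!: summable_mult2 summable_geometric summable_exp_reward simp: suminf_geometric_const)
  finally show ?thesis .
qed

lemma state_value_bounds:
  shows "(\<And>t. exp_reward m c t \<pi> s \<le> R) \<Longrightarrow> state_value m \<pi> s \<le> R / (1 - \<beta>)"
    and "(\<And>t. R \<le> exp_reward m c t \<pi> s) \<Longrightarrow> R / (1 - \<beta>) \<le> state_value m \<pi> s"
  unfolding state_value_def suminf_geometric_const[symmetric] using beta
  by (auto intro!: suminf_le summable_mult2 summable_geometric summable_exp_reward)

lemma state_value_first_step:
  "state_value m \<pi> s =
     (if \<pi> [] then of_bool s + \<beta> * (\<Sum>i=1..K. pobs c i s * step_mean s (state_value m (continue \<pi> (Some i))))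
      else m + \<beta> * step_mean s (state_value m (continue \<pi> None)))"
proof -
  have sm: "(\<lambda>t. \<beta> ^ t * step_mean s (exp_reward m c t \<pi>')) sums step_mean s (state_value m \<pi>')" for \<pi>'
  proof -
    have "(\<lambda>t. next_active c s * (\<beta> ^ t * exp_reward m c t \<pi>' True)
        + (1 - next_active c s) * (\<beta> ^ t * exp_reward m c t \<pi>' False)) sums step_mean s (state_value m \<pi>')"
      unfolding step_mean_def state_value_def
      by (intro sums_add sums_mult summable_sums summable_exp_reward)
    thus ?thesis by (simp add: step_mean_def algebra_simps)
  qed
  have "state_value m \<pi> s = exp_reward m c 0 \<pi> s + (\<Sum>t. \<beta> ^ Suc t * exp_reward m c (Suc t) \<pi> s)"
    unfolding state_value_def by (subst suminf_split_head[OF summable_exp_reward]) simp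
  also have "(\<Sum>t. \<beta> ^ Suc t * exp_reward m c (Suc t) \<pi> s) =
     \<beta> * (if \<pi> [] then \<Sum>i=1..K. pobs c i s * step_mean s (state_value m (continue \<pi> (Some i)))
      else step_mean s (state_value m (continue \<pi> None)))"
  proof (rule sums_unique[symmetric])
    show "(\<lambda>t. \<beta> ^ Suc t * exp_reward m c (Suc t) \<pi> s) sums (\<beta> * (if \<pi> [] then \<Sum>i=1..K. pobs c i s * step_mean s (state_value m (continue \<pi> (Some i)))
      else step_mean s (state_value m (continue \<pi> None))))"
    proof (cases "\<pi> []")
      case True
      have "(\<lambda>t. \<beta> * (\<Sum>i=1..K. pobs c i s * (\<beta> ^ t * step_mean s (exp_reward m c t (continue \<pi> (Some i))))))
          sums (\<beta> * (\<Sum>i=1..K. pobs c i s * step_mean s (state_value m (continue \<pi> (Some i)))))"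
        by (intro sums_mult sums_sum sm)
      thus ?thesis using True by (simp add: exp_reward_Suc sum_distrib_left mult_ac)
    next
      case False
      thus ?thesis using sums_mult[OF sm, of \<beta> "continue \<pi> None"] by (simp add: exp_reward_Suc mult_ac)
    qed
  qed
  finally show ?thesis by (simp add: exp_reward_0)
qed

lemma policy_value_passive:
  assumes w: "0 \<le> w" "w \<le> 1" and "\<not> \<pi> []"
  shows "policy_value \<beta> m c \<pi> w = m + \<beta> * policy_value \<beta> m c (continue \<pi> None) (evolve c w)"
  unfolding policy_value_eq[OF w] policy_value_eq[OF evolve_range[OF w]]
    state_value_first_step[of m \<pi>] using assms(3)
  by (simp add: step_mean_def next_active_def evolve_def algebra_simps)

lemma policy_value_active:
  assumes w: "0 \<le> w" "w \<le> 1" and "\<pi> []"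
  shows "policy_value \<beta> m c \<pi> w = w + \<beta> *
     (\<Sum>i=1..K. obs_prob c i w * policy_value \<beta> m c (continue \<pi> (Some i)) (post_evolve c i w))"
proof -
  have split: "obs_prob c i w * policy_value \<beta> m c \<pi>' (post_evolve c i w) =
      w * (pobs c i True * step_mean True (state_value m \<pi>'))
      + (1 - w) * (pobs c i False * step_mean False (state_value m \<pi>'))" for i \<pi>'
  proof -
    let ?f = "posterior c i w" and ?q = "obs_prob c i w"
    have "?q * policy_value \<beta> m c \<pi>' (post_evolve c i w) =
        (?q * ?f) * step_mean True (state_value m \<pi>')
        + (?q * (1 - ?f)) * step_mean False (state_value m \<pi>')"
      unfolding policy_value_eq[OF post_evolve_range[OF w]]
      by (simp add: post_evolve_def evolve_def step_mean_def next_active_def algebra_simps)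
    thus ?thesis unfolding bayes[OF w] by (simp add: algebra_simps)
  qed
  show ?thesis
    unfolding policy_value_eq[OF w] split sum.distrib sum_distrib_left[symmetric]
    unfolding state_value_first_step[of m \<pi>] using assms(3)
    by (simp add: algebra_simps)
qed

section \<open>The optimal value and its Bellman equation\<close>

definition value_bound :: "real \<Rightarrow> real" where
  "value_bound m = max 1 \<bar>m\<bar> / (1 - \<beta>)"

lemma abs_state_value_le: "\<bar>state_value m \<pi> s\<bar> \<le> value_bound m"
proof -
  have "state_value m \<pi> s \<le> max 1 \<bar>m\<bar> / (1 - \<beta>)"
    using abs_exp_reward_le by (intro state_value_bounds) (metis abs_le_iff)
  moreover have "- max 1 \<bar>m\<bar> / (1 - \<beta>) \<le> state_value m \<pi> s"
    using abs_exp_reward_le by (intro state_value_bounds) (metis abs_le_iff minus_le_iff)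
  ultimately show ?thesis by (simp add: value_bound_def)
qed

lemma mixture_le:
  fixes a b r w :: real
  assumes "0 \<le> w" "w \<le> 1" "a \<le> r" "b \<le> r"
  shows "w * a + (1 - w) * b \<le> r"
proof -
  have "w * a + (1 - w) * b \<le> w * r + (1 - w) * r"
    using assms by (intro add_mono mult_left_mono) auto
  thus ?thesis by (simp add: algebra_simps)
qed

lemma mixture_shift:
  fixes a b r w :: real
  shows "w * (a + r) + (1 - w) * (b + r) = w * a + (1 - w) * b + r"
  by (simp add: algebra_simps)

lemma policy_value_leI:
  assumes "0 \<le> w" "w \<le> 1" "\<And>s. state_value m \<pi> s \<le> r"
  shows "policy_value \<beta> m c \<pi> w \<le> r"
  unfolding policy_value_eq[OF assms(1,2)] using assms by (intro mixture_le) auto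

lemma bdd_above_policy_value:
  assumes "0 \<le> w" "w \<le> 1" shows "bdd_above (range (\<lambda>\<pi>. policy_value \<beta> m c \<pi> w))"
proof (rule bdd_aboveI2)
  show "policy_value \<beta> m c \<pi> w \<le> value_bound m" for \<pi>
    using assms abs_state_value_le by (intro policy_value_leI) (auto simp: abs_le_iff)
qed

lemma policy_value_le_opt_value:
  assumes "0 \<le> w" "w \<le> 1" shows "policy_value \<beta> m c \<pi> w \<le> opt_value \<beta> m c w"
  unfolding opt_value_def by (rule cSUP_upper[OF _ bdd_above_policy_value[OF assms]]) simp

lemma opt_value_leI: "(\<And>\<pi>. policy_value \<beta> m c \<pi> w \<le> r) \<Longrightarrow> opt_value \<beta> m c w \<le> r"
  unfolding opt_value_def by (rule cSUP_least) auto

lemma policy_near_opt_value: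
  assumes "0 \<le> w" "w \<le> 1" "0 < e"
  shows "\<exists>\<pi>. opt_value \<beta> m c w - e \<le> policy_value \<beta> m c \<pi> w"
proof (rule ccontr)
  assume "\<not> ?thesis"
  hence "opt_value \<beta> m c w \<le> opt_value \<beta> m c w - e"
    by (intro opt_value_leI) (metis le_cases)
  thus False using assms by simp
qed

text \<open>A first action followed by near-optimal policies for the resulting beliefs is itself a
  policy. Its decision after a nonempty history strips the first slot, the last entry of the list.\<close>

lemma value_passive_le_opt_value:
  assumes w: "0 \<le> w" "w \<le> 1" shows "value_passive \<beta> m c w \<le> opt_value \<beta> m c w"
proof (rule field_le_epsilon)
  fix e :: real assume e: "0 < e"
  obtain \<pi>' where p: "opt_value \<beta> m c (evolve c w) - e \<le> policy_value \<beta> m c \<pi>' (evolve c w)"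
    using policy_near_opt_value[OF evolve_range[OF w] e] by blast
  define \<pi> :: policy where "\<pi> = (\<lambda>h. h \<noteq> [] \<and> \<pi>' (butlast h))"
  have cont: "continue \<pi> None = \<pi>'" by (simp add: \<pi>_def continue_def)
  have "value_passive \<beta> m c w \<le> m + \<beta> * (policy_value \<beta> m c \<pi>' (evolve c w) + e)"
    unfolding value_passive_def using p beta by (intro add_left_mono mult_left_mono) auto
  also have "\<dots> = policy_value \<beta> m c \<pi> w + \<beta> * e"
    using policy_value_passive[OF w, of \<pi> m] unfolding cont by (simp add: \<pi>_def algebra_simps)
  also have "\<dots> \<le> opt_value \<beta> m c w + e"
    using policy_value_le_opt_value[OF w] beta e by (intro add_mono) auto
  finally show "value_passive \<beta> m c w \<le> opt_value \<beta> m c w + e" .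
qed

lemma value_active_le_opt_value:
  assumes w: "0 \<le> w" "w \<le> 1" shows "value_active K \<beta> m c w \<le> opt_value \<beta> m c w"
proof (rule field_le_epsilon)
  fix e :: real assume e: "0 < e"
  have "\<forall>i. \<exists>\<pi>'. opt_value \<beta> m c (post_evolve c i w) - e \<le> policy_value \<beta> m c \<pi>' (post_evolve c i w)"
    using policy_near_opt_value[OF post_evolve_range[OF w] e] by blast
  then obtain P where p: "opt_value \<beta> m c (post_evolve c i w) - e
      \<le> policy_value \<beta> m c (P i) (post_evolve c i w)" for i
    by metis
  define \<pi> :: policy where "\<pi> = (\<lambda>h. h = [] \<or> P (the (last h)) (butlast h))"
  have cont: "continue \<pi> (Some i) = P i" for i by (simp add: \<pi>_def continue_def)
  let ?v = "\<lambda>i. policy_value \<beta> m c (P i) (post_evolve c i w)"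
  have "(\<Sum>i=1..K. obs_prob c i w * opt_value \<beta> m c (post_evolve c i w))
      \<le> (\<Sum>i=1..K. obs_prob c i w * (?v i + e))"
    using p obs_prob_nonneg[OF w] by (intro sum_mono mult_left_mono) (auto simp: algebra_simps)
  also have "\<dots> = (\<Sum>i=1..K. obs_prob c i w * ?v i) + e"
    by (simp only: distrib_left sum.distrib sum_distrib_right[symmetric] sum_obs_prob mult_1)
  finally have "value_active K \<beta> m c w \<le> w + \<beta> * ((\<Sum>i=1..K. obs_prob c i w * ?v i) + e)"
    unfolding value_active_def using beta by (intro add_left_mono mult_left_mono) auto
  also have "\<dots> = policy_value \<beta> m c \<pi> w + \<beta> * e"
    using policy_value_active[OF w, of \<pi> m] unfolding cont by (simp add: \<pi>_def algebra_simps)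
  also have "\<dots> \<le> opt_value \<beta> m c w + e"
    using policy_value_le_opt_value[OF w] beta e by (intro add_mono) auto
  finally show "value_active K \<beta> m c w \<le> opt_value \<beta> m c w + e" .
qed

theorem bellman_equation:
  assumes w: "0 \<le> w" "w \<le> 1"
  shows "opt_value \<beta> m c w = max (value_active K \<beta> m c w) (value_passive \<beta> m c w)"
proof (rule antisym)
  show "opt_value \<beta> m c w \<le> max (value_active K \<beta> m c w) (value_passive \<beta> m c w)"
  proof (rule opt_value_leI)
    fix \<pi>
    show "policy_value \<beta> m c \<pi> w \<le> max (value_active K \<beta> m c w) (value_passive \<beta> m c w)"
    proof (cases "\<pi> []")
      case True
      have "policy_value \<beta> m c \<pi> w \<le> value_active K \<beta> m c w"
        unfolding policy_value_active[where \<pi> = \<pi>, OF w True] value_active_def using beta w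
        by (intro add_left_mono mult_left_mono sum_mono policy_value_le_opt_value
            post_evolve_range obs_prob_nonneg) auto
      thus ?thesis by simp
    next
      case False
      have "policy_value \<beta> m c \<pi> w \<le> value_passive \<beta> m c w"
        unfolding policy_value_passive[where \<pi> = \<pi>, OF w False] value_passive_def using beta w
        by (intro add_left_mono mult_left_mono policy_value_le_opt_value evolve_range) auto
      thus ?thesis by simp
    qed
  qed
qed (use value_active_le_opt_value[OF w] value_passive_le_opt_value[OF w] in auto)

lemma abs_opt_value_le:
  assumes w: "0 \<le> w" "w \<le> 1" shows "\<bar>opt_value \<beta> m c w\<bar> \<le> value_bound m"
proof -
  have "opt_value \<beta> m c w \<le> value_bound m"
    using w abs_state_value_le by (intro opt_value_leI policy_value_leI) (auto simp: abs_le_iff)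
  moreover have "w * - state_value m \<pi> True + (1 - w) * - state_value m \<pi> False \<le> value_bound m" for \<pi>
    using w abs_state_value_le by (intro mixture_le) (auto simp: abs_le_iff)
  hence "- value_bound m \<le> policy_value \<beta> m c (\<lambda>_. True) w"
    unfolding policy_value_eq[OF w] by (simp add: algebra_simps)
  hence "- value_bound m \<le> opt_value \<beta> m c w"
    using policy_value_le_opt_value[OF w] by (rule order.trans)
  ultimately show ?thesis by (simp add: abs_le_iff)
qed

lemma opt_value_nonneg:
  assumes w: "0 \<le> w" "w \<le> 1" shows "0 \<le> opt_value \<beta> m c w"
proof -
  have "0 / (1 - \<beta>) \<le> state_value m (\<lambda>_. True) s" for s
    by (intro state_value_bounds exp_value_bounds) auto
  hence "0 \<le> policy_value \<beta> m c (\<lambda>_. True) w" using w by (simp add: policy_value_eq)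
  thus ?thesis using policy_value_le_opt_value[OF w] by (rule order.trans)
qed

lemma opt_value_le:
  assumes w: "0 \<le> w" "w \<le> 1" and "m \<le> 1" shows "opt_value \<beta> m c w \<le> 1 / (1 - \<beta>)"
  using w assms(3) by (intro opt_value_leI policy_value_leI state_value_bounds exp_value_bounds) auto

lemma opt_value_subsidy_1:
  assumes w: "0 \<le> w" "w \<le> 1" shows "opt_value \<beta> 1 c w = 1 / (1 - \<beta>)"
proof (rule antisym)
  have "1 / (1 - \<beta>) \<le> state_value 1 (\<lambda>_. False) s" for s
    by (intro state_value_bounds exp_value_bounds) auto
  hence "w * (1 / (1 - \<beta>)) + (1 - w) * (1 / (1 - \<beta>)) \<le> policy_value \<beta> 1 c (\<lambda>_. False) w"
    unfolding policy_value_eq[OF w] using w by (intro add_mono mult_left_mono) auto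
  also have "\<dots> \<le> opt_value \<beta> 1 c w" by (rule policy_value_le_opt_value[OF w])
  finally show "1 / (1 - \<beta>) \<le> opt_value \<beta> 1 c w"
    using mixture_shift[of w 0 "1 / (1 - \<beta>)" 0] by simp
qed (use opt_value_le[OF w] in simp)

lemma opt_value_lipschitz_subsidy:
  assumes w: "0 \<le> w" "w \<le> 1"
  shows "\<bar>opt_value \<beta> m c w - opt_value \<beta> m' c w\<bar> \<le> \<bar>m - m'\<bar> / (1 - \<beta>)"
proof -
  have "opt_value \<beta> m c w \<le> opt_value \<beta> m' c w + \<bar>m - m'\<bar> / (1 - \<beta>)" for m m'
  proof (rule opt_value_leI)
    fix \<pi>
    have "state_value m \<pi> s \<le> state_value m' \<pi> s + \<bar>m - m'\<bar> / (1 - \<beta>)" for s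
      by (intro state_value_le_shift exp_reward_le_shift) auto
    hence "policy_value \<beta> m c \<pi> w \<le> w * (state_value m' \<pi> True + \<bar>m - m'\<bar> / (1 - \<beta>))
        + (1 - w) * (state_value m' \<pi> False + \<bar>m - m'\<bar> / (1 - \<beta>))"
      unfolding policy_value_eq[OF w] using w by (intro add_mono mult_left_mono) auto
    also have "\<dots> = policy_value \<beta> m' c \<pi> w + \<bar>m - m'\<bar> / (1 - \<beta>)"
      unfolding policy_value_eq[OF w] by (rule mixture_shift)
    also have "\<dots> \<le> opt_value \<beta> m' c w + \<bar>m - m'\<bar> / (1 - \<beta>)"
      using policy_value_le_opt_value[OF w] by simp
    finally show "policy_value \<beta> m c \<pi> w \<le> opt_value \<beta> m' c w + \<bar>m - m'\<bar> / (1 - \<beta>)" .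
  qed
  from this[of m m'] this[of m' m] show ?thesis by (simp add: abs_minus_commute abs_le_iff)
qed

lemma convex_opt_value: "convex_on {0..1} (opt_value \<beta> m c)"
proof (rule convex_onI)
  fix t x y :: real assume t: "0 < t" "t < 1" and xy: "x \<in> {0..1}" "y \<in> {0..1}"
  define z where "z = (1 - t) * x + t * y"
  have z: "0 \<le> z" "z \<le> 1" unfolding z_def using t xy mixture_le[of t y 1 x] by (auto simp: add.commute)
  have "opt_value \<beta> m c z \<le> (1 - t) * opt_value \<beta> m c x + t * opt_value \<beta> m c y"
  proof (rule opt_value_leI)
    fix \<pi>
    have "policy_value \<beta> m c \<pi> z = (1 - t) * policy_value \<beta> m c \<pi> x + t * policy_value \<beta> m c \<pi> y"
      using xy by (subst (1 2 3) policy_value_eq) (use z in \<open>auto simp: z_def algebra_simps\<close>)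
    also have "\<dots> \<le> (1 - t) * opt_value \<beta> m c x + t * opt_value \<beta> m c y"
      using xy t by (intro add_mono mult_left_mono policy_value_le_opt_value) auto
    finally show "policy_value \<beta> m c \<pi> z \<le> (1 - t) * opt_value \<beta> m c x + t * opt_value \<beta> m c y" .
  qed
  thus "opt_value \<beta> m c ((1 - t) *\<^sub>R x + t *\<^sub>R y) \<le> (1 - t) * opt_value \<beta> m c x + t * opt_value \<beta> m c y"
    by (simp add: z_def)
qed simp

lemma convex_opt_value_evolve: "convex_on {0..1} (\<lambda>x. opt_value \<beta> m c (evolve c x))"
proof (rule convex_onI)
  fix t x y :: real assume t: "0 < t" "t < 1" and xy: "x \<in> {0..1}" "y \<in> {0..1}"
  have "evolve c ((1 - t) *\<^sub>R x + t *\<^sub>R y) = (1 - t) *\<^sub>R evolve c x + t *\<^sub>R evolve c y"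
    by (simp add: evolve_def algebra_simps)
  thus "opt_value \<beta> m c (evolve c ((1 - t) *\<^sub>R x + t *\<^sub>R y))
      \<le> (1 - t) * opt_value \<beta> m c (evolve c x) + t * opt_value \<beta> m c (evolve c y)"
    using convex_onD[OF convex_opt_value, of t "evolve c x" "evolve c y" m] t xy evolve_range by simp
qed simp

text \<open>A crude Lipschitz bound, which only serves to start the iteration in the proof of
  \<open>advantage_mono\<close>.\<close>

lemma slopes_in_opt_value: "slopes_in (opt_value \<beta> m c) (- (2 * value_bound m)) (2 * value_bound m)"
proof -
  have le: "opt_value \<beta> m c x \<le> opt_value \<beta> m c y + 2 * value_bound m * \<bar>x - y\<bar>"
    if "0 \<le> x" "x \<le> 1" "0 \<le> y" "y \<le> 1" for x y
  proof (rule opt_value_leI)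
    fix \<pi>
    have "policy_value \<beta> m c \<pi> x - policy_value \<beta> m c \<pi> y
        = (x - y) * (state_value m \<pi> True - state_value m \<pi> False)"
      using that by (simp add: policy_value_eq algebra_simps)
    also have "\<dots> \<le> \<bar>x - y\<bar> * \<bar>state_value m \<pi> True - state_value m \<pi> False\<bar>"
      by (metis abs_ge_self abs_mult)
    also have "\<dots> \<le> \<bar>x - y\<bar> * (2 * value_bound m)"
      using abs_state_value_le[of m \<pi> True] abs_state_value_le[of m \<pi> False]
      by (intro mult_left_mono) auto
    finally show "policy_value \<beta> m c \<pi> x \<le> opt_value \<beta> m c y + 2 * value_bound m * \<bar>x - y\<bar>"
      using policy_value_le_opt_value[of y m \<pi>] that by (simp add: mult.commute)
  qed
  show ?thesis unfolding slopes_in_def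
  proof (intro allI impI)
    fix x y :: real assume xy: "0 \<le> x" "x \<le> y" "y \<le> 1"
    show "- (2 * value_bound m) * (y - x) \<le> opt_value \<beta> m c y - opt_value \<beta> m c x \<and>
        opt_value \<beta> m c y - opt_value \<beta> m c x \<le> 2 * value_bound m * (y - x)"
      using le[of x y] le[of y x] xy by simp
  qed
qed

section \<open>The advantage of activation grows with the belief\<close>

definition advantage :: "real \<Rightarrow> real \<Rightarrow> real" where
  "advantage m x = value_active K \<beta> m c x - value_passive \<beta> m c x"

lemma slopes_in_active_continuation:
  assumes "slopes_in (\<lambda>x. opt_value \<beta> m c (evolve c x)) l u"
  shows "slopes_in (\<lambda>x. \<Sum>i=1..K. obs_prob c i x * opt_value \<beta> m c (post_evolve c i x)) l u"
proof -
  have "slopes_in (\<lambda>x. \<Sum>i=1..K. perspective (\<lambda>x. opt_value \<beta> m c (evolve c x))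
      (pobs c i True * x) (pobs c i False * (1 - x))) l u"
    by (intro slopes_in_experiment convex_opt_value_evolve assms sum_pobs pobs_nonneg)
  thus ?thesis by (simp add: perspective_def obs_prob_def post_evolve_def posterior_def)
qed

lemma slopes_in_bellman:
  assumes "slopes_in (\<lambda>x. opt_value \<beta> m c (evolve c x)) l u"
  shows "slopes_in (opt_value \<beta> m c) (\<beta> * l) (1 + \<beta> * u)"
  unfolding slopes_in_def
proof (intro allI impI)
  fix x y :: real assume xy: "0 \<le> x" "x \<le> y" "y \<le> 1"
  note F = slopes_inD[OF slopes_in_active_continuation[OF assms] xy]
  note G = slopes_inD[OF assms xy]
  have "\<beta> * (l * (y - x)) \<le> value_passive \<beta> m c y - value_passive \<beta> m c x"
    "value_passive \<beta> m c y - value_passive \<beta> m c x \<le> \<beta> * (u * (y - x))"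
    using mult_left_mono[OF G(1), of \<beta>] mult_left_mono[OF G(2), of \<beta>] beta
    by (simp_all add: value_passive_def algebra_simps)
  moreover have "(y - x) + \<beta> * (l * (y - x)) \<le> value_active K \<beta> m c y - value_active K \<beta> m c x"
    "value_active K \<beta> m c y - value_active K \<beta> m c x \<le> (y - x) + \<beta> * (u * (y - x))"
    using mult_left_mono[OF F(1), of \<beta>] mult_left_mono[OF F(2), of \<beta>] beta
    by (simp_all add: value_active_def algebra_simps)
  ultimately show "\<beta> * l * (y - x) \<le> opt_value \<beta> m c y - opt_value \<beta> m c x \<and>
      opt_value \<beta> m c y - opt_value \<beta> m c x \<le> (1 + \<beta> * u) * (y - x)"
    using xy by (simp add: bellman_equation distrib_right max_def)
qed

lemma slopes_in_evolve:
  assumes G: "slopes_in G l u"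
  defines "d \<equiv> p11 c - p01 c"
  shows "0 \<le> d \<Longrightarrow> slopes_in (\<lambda>x. G (evolve c x)) (d * l) (d * u)"
    and "d \<le> 0 \<Longrightarrow> slopes_in (\<lambda>x. G (evolve c x)) (d * u) (d * l)"
proof -
  have diff: "evolve c y - evolve c x = d * (y - x)" for x y
    by (simp add: evolve_eq d_def algebra_simps)
  show "slopes_in (\<lambda>x. G (evolve c x)) (d * l) (d * u)" if d: "0 \<le> d"
    unfolding slopes_in_def
  proof (intro allI impI)
    fix x y :: real assume xy: "0 \<le> x" "x \<le> y" "y \<le> 1"
    have "0 \<le> d * (y - x)" using d xy by simp
    hence "evolve c x \<le> evolve c y" using diff[of y x] by linarith
    thus "d * l * (y - x) \<le> G (evolve c y) - G (evolve c x) \<and>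
        G (evolve c y) - G (evolve c x) \<le> d * u * (y - x)"
      using slopes_inD[OF G, of "evolve c x" "evolve c y"] evolve_range[of x] evolve_range[of y] xy
      unfolding diff by (simp add: mult_ac)
  qed
  show "slopes_in (\<lambda>x. G (evolve c x)) (d * u) (d * l)" if d: "d \<le> 0"
    unfolding slopes_in_def
  proof (intro allI impI)
    fix x y :: real assume xy: "0 \<le> x" "x \<le> y" "y \<le> 1"
    have "d * (y - x) \<le> 0" using d xy by (simp add: mult_nonpos_nonneg)
    hence "evolve c y \<le> evolve c x" using diff[of y x] by linarith
    thus "d * u * (y - x) \<le> G (evolve c y) - G (evolve c x) \<and>
        G (evolve c y) - G (evolve c x) \<le> d * l * (y - x)"
      using slopes_inD[OF G, of "evolve c y" "evolve c x"] evolve_range[of x] evolve_range[of y] xy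
      unfolding diff[of x y] by (simp add: algebra_simps)
  qed
qed

text \<open>Passing through the Bellman equation keeps the lower end of the slopes up to the factor
  \<open>\<beta>\<close>, and adds the slope 1 of the immediate reward to the upper end; the belief dynamics then
  scales all slopes by \<open>p11 c - p01 c\<close>, exchanging the ends if this is negative. The width of the
  interval obeys the same recursion for both signs.\<close>

lemma slope_width_step:
  assumes "slopes_in (\<lambda>x. opt_value \<beta> m c (evolve c x)) l u"
  shows "\<exists>l' u'. slopes_in (\<lambda>x. opt_value \<beta> m c (evolve c x)) l' u'
           \<and> u' - l' = \<bar>p11 c - p01 c\<bar> * (1 + \<beta> * (u - l))"
proof -
  note b = slopes_in_evolve[OF slopes_in_bellman[OF assms]]
  show ?thesis
  proof (cases "0 \<le> p11 c - p01 c")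
    case True
    show ?thesis using b(1)[OF True] True by (intro exI conjI) (auto simp: algebra_simps)
  next
    case False
    thus ?thesis using b(2) by (intro exI conjI) (auto simp: algebra_simps)
  qed
qed

text \<open>The difference of the continuation values after activation and after passivity has slopes at
  least \<open>- (u - l)\<close> if those of \<open>\<lambda>x. opt_value \<beta> m c (evolve c x)\<close> are in \<open>[l, u]\<close>. The
  width \<open>u - l\<close> can be pushed arbitrarily close to the fixed point \<open>r\<close> of the recursion of \<open>slope_width_step\<close>, and
  \<open>\<beta> * r \<le> 1\<close> is equivalent to \<open>\<beta> * a \<le> 1 / 2\<close>. Then the slope 1 of the immediate
  reward outweighs the continuation.\<close>

lemma advantage_mono:
  assumes d: "\<beta> * \<bar>p11 c - p01 c\<bar> \<le> 1 / 2" and xy: "0 \<le> x" "x \<le> y" "y \<le> 1"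
  shows "advantage m x \<le> advantage m y"
proof -
  define a where "a = \<bar>p11 c - p01 c\<bar>"
  define r where "r = a / (1 - \<beta> * a)"
  have a: "0 \<le> \<beta> * a" "\<beta> * a \<le> 1 / 2" using d beta by (auto simp: a_def)
  have r: "a * (1 + \<beta> * r) = r" using a by (simp add: r_def field_simps)
  have br: "\<beta> * r \<le> 1" using a by (simp add: r_def field_simps)
  define r0 where "r0 = a * (4 * value_bound m)"
  have ex: "\<exists>l u. slopes_in (\<lambda>x. opt_value \<beta> m c (evolve c x)) l u \<and> u - l = r + (\<beta> * a) ^ n * (r0 - r)" for n
  proof (induction n)
    case 0
    note b = slopes_in_evolve[OF slopes_in_opt_value[of m]]
    show ?case
    proof (cases "0 \<le> p11 c - p01 c")
      case True
      show ?thesis using b(1)[OF True] True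
        by (intro exI conjI) (auto simp: r0_def a_def algebra_simps)
    next
      case False
      thus ?thesis using b(2) by (intro exI conjI) (auto simp: r0_def a_def algebra_simps)
    qed
  next
    case (Suc n)
    then obtain l u where "slopes_in (\<lambda>x. opt_value \<beta> m c (evolve c x)) l u"
      and w: "u - l = r + (\<beta> * a) ^ n * (r0 - r)" by blast
    then obtain l' u' where "slopes_in (\<lambda>x. opt_value \<beta> m c (evolve c x)) l' u'"
      "u' - l' = a * (1 + \<beta> * (u - l))"
      using slope_width_step a_def by blast
    moreover have "a * (1 + \<beta> * (u - l)) = a * (1 + \<beta> * r) + (\<beta> * a) ^ Suc n * (r0 - r)"
      unfolding w by (simp add: algebra_simps)
    ultimately show ?case using r by auto
  qed
  have bound: "(1 - \<beta> * (r + (\<beta> * a) ^ n * (r0 - r))) * (y - x) \<le> advantage m y - advantage m x" for n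
  proof -
    obtain l u where s: "slopes_in (\<lambda>x. opt_value \<beta> m c (evolve c x)) l u"
      and w: "u - l = r + (\<beta> * a) ^ n * (r0 - r)" using ex by blast
    have "(y - x) + \<beta> * ((l - u) * (y - x)) \<le> advantage m y - advantage m x"
      using slopes_inD(1)[OF slopes_in_active_continuation[OF s] xy, THEN mult_left_mono, of \<beta>]
        slopes_inD(2)[OF s xy, THEN mult_left_mono, of \<beta>] beta
      by (simp add: advantage_def value_active_def value_passive_def algebra_simps)
    moreover have "(y - x) + \<beta> * ((l - u) * (y - x)) = (1 - \<beta> * (u - l)) * (y - x)"
      by (simp add: algebra_simps)
    ultimately show ?thesis unfolding w by simp
  qed
  have "(\<lambda>n. (1 - \<beta> * (r + (\<beta> * a) ^ n * (r0 - r))) * (y - x))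
      \<longlonglongrightarrow> (1 - \<beta> * (r + 0 * (r0 - r))) * (y - x)"
    using a by (intro tendsto_intros LIMSEQ_realpow_zero) auto
  hence "(1 - \<beta> * r) * (y - x) \<le> advantage m y - advantage m x"
    using bound by (intro LIMSEQ_le_const2) auto
  moreover have "0 \<le> (1 - \<beta> * r) * (y - x)" using br xy by simp
  ultimately show ?thesis by linarith
qed

end

section \<open>Waiting for the belief to exceed the threshold\<close>

lemma hit_cases:
  obtains (never) "hit c w x = \<infinity>" "\<And>k. (evolve c ^^ k) x \<le> w"
  | (hit) l where "hit c w x = enat l" "w < (evolve c ^^ l) x" "\<And>k. k < l \<Longrightarrow> (evolve c ^^ k) x \<le> w"
proof (cases "\<exists>k. w < (evolve c ^^ k) x")
  case True
  define l where "l = (LEAST k. w < (evolve c ^^ k) x)"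
  have above: "w < (evolve c ^^ l) x" unfolding l_def using True by (rule LeastI_ex)
  have below: "(evolve c ^^ k) x \<le> w" if "k < l" for k
    using not_less_Least[OF that[unfolded l_def]] by simp
  have "hit c w x = enat l"
    using above by (rule hit_eq_enat) (simp add: l_def Least_le)
  thus ?thesis using above below by (rule hit)
next
  case False
  hence below: "(evolve c ^^ k) x \<le> w" for k by (simp add: not_less)
  show ?thesis by (rule never[OF hit_eq_infinity[OF below] below])
qed

context single_channel
begin

lemma evolve_funpow_range:
  assumes "0 \<le> x" "x \<le> 1" shows "0 \<le> (evolve c ^^ k) x" "(evolve c ^^ k) x \<le> 1"
  using assms by (induction k) (auto simp: evolve_range)

lemma hit_belief_range:
  assumes "0 \<le> x" "x \<le> 1" shows "0 \<le> hit_belief c w x" "hit_belief c w x \<le> 1"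
  using assms by (auto simp: hit_belief_def evolve_funpow_range)

lemma next_belief_range:
  assumes "0 \<le> x" "x \<le> 1" shows "0 \<le> next_belief c w i x" "next_belief c w i x \<le> 1"
  using assms by (auto simp: next_belief_def post_evolve_range hit_belief_range)

lemma evolve_eq_fixpt: "evolve c x = fixpt c + (p11 c - p01 c) * (x - fixpt c)"
  using evolve_funpow[OF valid, of 1 x] by simp

text \<open>A passive step that does not raise the belief \<open>w\<close> shows that \<open>w\<close> is at least the fixed
  point. All later passive beliefs are closer to the fixed point, hence never above \<open>w\<close>.\<close>

lemma never_hit_after_decrease:
  assumes "evolve c w \<le> w"
  shows "hit c w (evolve c w) = \<infinity>"
proof (rule hit_eq_infinity)
  fix k
  let ?d = "p11 c - p01 c"
  have d: "\<bar>?d\<bar> < 1" using transition_probs by auto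
  have "0 \<le> (1 - ?d) * (w - fixpt c)" using assms unfolding evolve_eq_fixpt by (simp add: algebra_simps)
  hence "0 \<le> w - fixpt c" using d by (auto simp: zero_le_mult_iff abs_less_iff)
  moreover have "?d ^ Suc k \<le> 1"
  proof -
    have "\<bar>?d ^ Suc k\<bar> \<le> 1" unfolding power_abs using d by (intro power_le_one) auto
    thus ?thesis by (rule abs_le_D1)
  qed
  ultimately have "?d ^ Suc k * (w - fixpt c) \<le> 1 * (w - fixpt c)" by (intro mult_right_mono)
  moreover have "(evolve c ^^ k) (evolve c w) = fixpt c + ?d ^ Suc k * (w - fixpt c)"
    using evolve_funpow[OF valid, of "Suc k" w] by (simp add: funpow_swap1)
  ultimately show "(evolve c ^^ k) (evolve c w) \<le> w" by simp
qed

lemma fixpt_eq: "fixpt c = p01 c + (p11 c - p01 c) * fixpt c"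
proof -
  have "evolve c (fixpt c) = fixpt c" unfolding evolve_eq_fixpt by simp
  thus ?thesis unfolding evolve_eq by (rule sym)
qed

lemma increase_imp_below:
  assumes "w < evolve c w" "p11 c < p01 c" shows "w < p01 c"
proof -
  let ?d = "p11 c - p01 c"
  have "0 < (1 - ?d) * (fixpt c - w)" using assms(1) unfolding evolve_eq_fixpt by (simp add: algebra_simps)
  hence "w < fixpt c" using assms by (simp add: zero_less_mult_iff)
  moreover have "0 < fixpt c" unfolding fixpt_def using transition_probs assms by simp
  hence "?d * fixpt c \<le> 0" using assms by (simp add: mult_nonpos_nonneg)
  hence "fixpt c \<le> p01 c" using fixpt_eq by linarith
  ultimately show ?thesis by linarith
qed

text \<open>Both distributions have total mass 1, so neither can be exceeded by the other at every point
  of its support.\<close>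

lemma likely_observation: "\<exists>i\<in>{1..K}. pobs c i (\<not> s) \<le> pobs c i s \<and> 0 < pobs c i s"
proof (rule ccontr)
  assume no: "\<not> ?thesis"
  have le: "pobs c i s \<le> pobs c i (\<not> s)" if "i \<in> {1..K}" for i
    using no that pobs_nonneg[of i "\<not> s"] by force
  have "\<exists>i\<in>{1..K}. 0 < pobs c i s"
  proof (rule ccontr)
    assume "\<not> ?thesis"
    hence "(\<Sum>i=1..K. pobs c i s) \<le> 0" by (intro sum_nonpos) (auto simp: not_less)
    thus False by (simp only: sum_pobs)
  qed
  hence "\<exists>i\<in>{1..K}. pobs c i s < pobs c i (\<not> s)" using no by force
  hence "(\<Sum>i=1..K. pobs c i s) < (\<Sum>i=1..K. pobs c i (\<not> s))"
    using le by (intro sum_strict_mono_ex1) auto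
  thus False by (simp only: sum_pobs)
qed

lemma posterior_ge:
  assumes "0 \<le> w" "w \<le> 1" "pobs c i False \<le> pobs c i True" "0 < obs_prob c i w"
  shows "w \<le> posterior c i w"
proof -
  have "pobs c i False * (w * (1 - w)) \<le> pobs c i True * (w * (1 - w))"
    using assms by (intro mult_right_mono) auto
  hence "w * obs_prob c i w \<le> pobs c i True * w" by (simp add: obs_prob_def algebra_simps)
  thus ?thesis using assms by (simp add: posterior_def le_divide_eq)
qed

lemma posterior_le:
  assumes "0 \<le> w" "w \<le> 1" "pobs c i True \<le> pobs c i False" "0 < obs_prob c i w"
  shows "posterior c i w \<le> w"
proof -
  have "pobs c i True * (w * (1 - w)) \<le> pobs c i False * (w * (1 - w))"
    using assms by (intro mult_right_mono) auto
  hence "pobs c i True * w \<le> w * obs_prob c i w" by (simp add: obs_prob_def algebra_simps)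
  thus ?thesis using assms by (simp add: posterior_def divide_le_eq)
qed

text \<open>Suppose that the belief increases under passivity. The state that is more likely to be followed
  by 1 is 1 if \<open>p01 c < p11 c\<close>, and 0 otherwise; an observation that favours it leads to a belief of
  at least \<open>evolve c w > w\<close>. Such an observation exists by \<open>likely_observation\<close>, and its
  probability is bounded below uniformly in \<open>w\<close>: in the second case \<open>w < p01 c\<close>, so state 0 has
  probability more than \<open>1 - p01 c\<close>; in the first case state 1 has probability at least
  \<open>p01 c\<close>, unless \<open>w < p01 c\<close> and then every active step ends above \<open>w\<close>.\<close>

lemma probability_above_threshold:
  "\<exists>\<delta>>0. \<delta> \<le> 1 \<and> (\<forall>w. 0 \<le> w \<longrightarrow> w \<le> 1 \<longrightarrow> w < evolve c w \<longrightarrow>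
      \<delta> \<le> (\<Sum>i\<in>{i\<in>{1..K}. w < post_evolve c i w}. obs_prob c i w))"
proof -
  define s where "s = (p01 c < p11 c)"
  obtain i where i: "i \<in> {1..K}" "pobs c i (\<not> s) \<le> pobs c i s" "0 < pobs c i s"
    using likely_observation by blast
  have p: "0 < p01 c" "p01 c < 1" by (rule transition_probs)+
  define \<delta> where "\<delta> = p01 c * (1 - p01 c) * pobs c i s"
  have pp: "p01 c * (1 - p01 c) \<le> p01 c" "p01 c * (1 - p01 c) \<le> 1 - p01 c"
    using p by (simp_all add: mult_le_cancel_left1 mult_le_cancel_right1)
  have q: "pobs c i s \<le> 1" by (simp add: pobs_def pmf_le_1)
  have pos: "0 < \<delta>" using p i by (simp add: \<delta>_def)
  have "p01 c * (1 - p01 c) \<le> 1" using pp(1) p(2) by linarith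
  hence "p01 c * (1 - p01 c) * pobs c i s \<le> 1 * 1" using i q by (intro mult_mono) simp_all
  hence le1: "\<delta> \<le> 1" by (simp add: \<delta>_def)
  have "\<delta> \<le> (\<Sum>i\<in>{i\<in>{1..K}. w < post_evolve c i w}. obs_prob c i w)"
    if w: "0 \<le> w" "w \<le> 1" and inc: "w < evolve c w" for w
  proof (cases "s \<and> w < p01 c")
    case True
    have "w < post_evolve c j w" for j
    proof -
      have "0 \<le> (p11 c - p01 c) * posterior c j w"
        using True posterior_range(1)[OF w, of j] by (simp add: s_def)
      thus ?thesis using True by (simp add: post_evolve_def evolve_eq)
    qed
    hence "{i\<in>{1..K}. w < post_evolve c i w} = {1..K}" by auto
    thus ?thesis using le1 by (simp only: sum_obs_prob)
  next
    case False
    have "\<delta> \<le> obs_prob c i w"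
    proof (cases s)
      case True
      have "\<delta> \<le> w * pobs c i s"
        unfolding \<delta>_def using pp False True i by (intro mult_right_mono) auto
      also have "\<dots> \<le> obs_prob c i w" using True w pobs_nonneg[of i False] by (simp add: obs_prob_def)
      finally show ?thesis .
    next
      case False
      hence "w < p01 c" using increase_imp_below[OF inc] transition_probs(5) by (simp add: s_def)
      hence "\<delta> \<le> (1 - w) * pobs c i s"
        unfolding \<delta>_def using pp i by (intro mult_right_mono) auto
      also have "\<dots> \<le> obs_prob c i w" using False w pobs_nonneg[of i True] by (simp add: obs_prob_def)
      finally show ?thesis .
    qed
    moreover have "evolve c w \<le> post_evolve c i w"
    proof -
      have op: "0 < obs_prob c i w" using pos calculation by linarith
      have "(p11 c - p01 c) * w \<le> (p11 c - p01 c) * posterior c i w"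
      proof (cases s)
        case True
        thus ?thesis using posterior_ge[OF w _ op] i by (simp add: s_def)
      next
        case False
        thus ?thesis using posterior_le[OF w _ op] i by (simp add: s_def mult_left_mono_neg)
      qed
      thus ?thesis by (simp add: post_evolve_def evolve_eq)
    qed
    hence "obs_prob c i w \<le> (\<Sum>i\<in>{i\<in>{1..K}. w < post_evolve c i w}. obs_prob c i w)"
      using inc i w by (intro member_le_sum) (auto intro: obs_prob_nonneg)
    ultimately show ?thesis by linarith
  qed
  thus ?thesis using pos le1 by blast
qed

end

context discounted_channel
begin

section \<open>The denominators of the approximated indices\<close>

lemma disc_range: "0 \<le> disc \<beta> L" "disc \<beta> L \<le> 1"
  using beta by (auto simp: disc_def power_le_one split: enat.split)

lemma b3_nonneg: "0 \<le> x \<Longrightarrow> x \<le> 1 \<Longrightarrow> 0 \<le> b3 \<beta> c w i x"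
  using beta by (simp add: b3_def disc_range obs_prob_nonneg hit_belief_range)

lemma sum_b3: "(\<Sum>i=1..K. b3 \<beta> c w i x) = \<beta> * disc \<beta> (hit c w x)"
  unfolding b3_def sum_distrib_left[symmetric] by (simp only: sum_obs_prob)

lemma k_iter_nonneg: "0 \<le> x \<Longrightarrow> x \<le> 1 \<Longrightarrow> 0 \<le> k_iter K \<beta> c w j x"
proof (induction j arbitrary: x)
  case 0
  show ?case using beta by (simp add: b1_def disc_range)
next
  case (Suc j)
  have "0 \<le> (\<Sum>i=1..K. b3 \<beta> c w i x * k_iter K \<beta> c w j (next_belief c w i x))"
    using Suc.prems by (intro sum_nonneg mult_nonneg_nonneg b3_nonneg Suc.IH next_belief_range)
  moreover have "0 \<le> b1 \<beta> c w x" using beta by (simp add: b1_def disc_range)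
  ultimately show ?case by simp
qed

text \<open>\<open>k_iter\<close> is the discounted number of passive slots of the threshold policy, truncated
  after finitely many activations. It is at most \<open>1 / (1 - \<beta>)\<close>, the discounted number of all slots;
  the first activation takes away the discount factor of its slot.\<close>

lemma k_iter_le: "0 \<le> x \<Longrightarrow> x \<le> 1 \<Longrightarrow> k_iter K \<beta> c w j x \<le> 1 / (1 - \<beta>) - disc \<beta> (hit c w x)"
proof (induction j arbitrary: x)
  case 0
  let ?D = "disc \<beta> (hit c w x)"
  have "?D * (1 - \<beta>) \<le> ?D * 1" using disc_range beta by (intro mult_left_mono) auto
  thus ?case using beta by (simp add: b1_def field_simps)
next
  case (Suc j)
  let ?D = "disc \<beta> (hit c w x)"
  have "k_iter K \<beta> c w j y \<le> 1 / (1 - \<beta>)" if "0 \<le> y" "y \<le> 1" for y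
    using Suc.IH[OF that] disc_range(1)[of "hit c w y"] by linarith
  hence "(\<Sum>i=1..K. b3 \<beta> c w i x * k_iter K \<beta> c w j (next_belief c w i x))
      \<le> (\<Sum>i=1..K. b3 \<beta> c w i x * (1 / (1 - \<beta>)))"
    using Suc.prems by (intro sum_mono mult_left_mono b3_nonneg) (auto simp: next_belief_range)
  also have "\<dots> = \<beta> * ?D * (1 / (1 - \<beta>))"
    unfolding sum_distrib_right[symmetric] sum_b3 ..
  finally have "k_iter K \<beta> c w (Suc j) x \<le> (1 - ?D) / (1 - \<beta>) + \<beta> * ?D * (1 / (1 - \<beta>))"
    by (simp add: b1_def)
  also have "\<dots> = (1 - ?D * (1 - \<beta>)) / (1 - \<beta>)"
    by (simp add: add_divide_distrib[symmetric] algebra_simps)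
  also have "\<dots> = 1 / (1 - \<beta>) - ?D" using beta by (simp add: diff_divide_distrib)
  finally show ?case .
qed

lemma k_iter_never: "hit c w x = \<infinity> \<Longrightarrow> k_iter K \<beta> c w j x = 1 / (1 - \<beta>)"
  by (cases j) (simp_all add: b1_def b3_def disc_def)

text \<open>If the belief does not increase under passivity, the threshold policy stays passive for
  ever from \<open>evolve c w\<close>, so that \<open>k_iter\<close> is maximal there and the denominator is at least 1.
  Otherwise the trivial estimate \<open>\<beta> / (1 - \<beta>) \<le> 1\<close> makes the denominator
  nonnegative, and the observations of \<open>probability_above_threshold\<close>, after which the next slot is
  active, give the margin \<open>\<beta> * \<delta>\<close>.\<close>

lemma approx_den_lower_bound:
  assumes "\<beta> \<le> 1 / 2"
  shows "\<exists>\<delta>>0. \<forall>w j. 0 \<le> w \<longrightarrow> w \<le> 1 \<longrightarrow> \<delta> \<le> approx_den K \<beta> j c w"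
proof -
  obtain \<delta> where \<delta>: "0 < \<delta>" "\<delta> \<le> 1"
    and mass: "\<And>w. 0 \<le> w \<Longrightarrow> w \<le> 1 \<Longrightarrow> w < evolve c w \<Longrightarrow>
      \<delta> \<le> (\<Sum>i\<in>{i\<in>{1..K}. w < post_evolve c i w}. obs_prob c i w)"
    using probability_above_threshold by blast
  have "\<beta> * \<delta> \<le> approx_den K \<beta> j c w" if w: "0 \<le> w" "w \<le> 1" for w j
  proof -
    let ?S = "\<Sum>i=1..K. obs_prob c i w * k_iter K \<beta> c w j (post_evolve c i w)"
    let ?A = "{i\<in>{1..K}. w < post_evolve c i w}"
    have le: "k_iter K \<beta> c w j (post_evolve c i w) \<le> 1 / (1 - \<beta>) - of_bool (w < post_evolve c i w)" for i
    proof (cases "w < post_evolve c i w")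
      case True
      hence "hit c w (post_evolve c i w) = enat 0" by (intro hit_eq_enat) auto
      thus ?thesis using k_iter_le[OF post_evolve_range[OF w], of w j i] True by (simp add: disc_def)
    next
      case False
      thus ?thesis using k_iter_le[OF post_evolve_range[OF w], of w j i]
          disc_range(1)[of "hit c w (post_evolve c i w)"] by simp
    qed
    have "?S \<le> (\<Sum>i=1..K. obs_prob c i w * (1 / (1 - \<beta>) - of_bool (w < post_evolve c i w)))"
      using le obs_prob_nonneg[OF w] by (intro sum_mono mult_left_mono) auto
    also have "\<dots> = (\<Sum>i=1..K. obs_prob c i w) * (1 / (1 - \<beta>)) - (\<Sum>i=1..K. if w < post_evolve c i w then obs_prob c i w else 0)"
      unfolding sum_distrib_right sum_subtractf[symmetric] by (intro sum.cong) (auto simp: algebra_simps)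
    also have "(\<Sum>i=1..K. if w < post_evolve c i w then obs_prob c i w else 0) = (\<Sum>i\<in>?A. obs_prob c i w)"
      by (intro sum.inter_filter[symmetric]) simp
    finally have S: "?S \<le> 1 / (1 - \<beta>) - (\<Sum>i\<in>?A. obs_prob c i w)"
      by (simp only: sum_obs_prob mult_1)
    have b: "\<beta> * (1 / (1 - \<beta>)) \<le> 1" using assms beta by (simp add: field_simps)
    show ?thesis
    proof (cases "w < evolve c w")
      case True
      have "?S \<le> 1 / (1 - \<beta>) - \<delta>" using S mass[OF w True] by linarith
      hence "\<beta> * ?S \<le> \<beta> * (1 / (1 - \<beta>) - \<delta>)" using beta by (intro mult_left_mono) auto
      moreover have "0 \<le> \<beta> * k_iter K \<beta> c w j (evolve c w)"
        using beta w by (simp add: k_iter_nonneg evolve_range)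
      ultimately show ?thesis using b by (simp add: approx_den_def right_diff_distrib)
    next
      case False
      hence "k_iter K \<beta> c w j (evolve c w) = 1 / (1 - \<beta>)"
        by (intro k_iter_never never_hit_after_decrease) simp
      moreover have "0 \<le> (\<Sum>i\<in>?A. obs_prob c i w)" using w by (intro sum_nonneg obs_prob_nonneg)
      ultimately have "0 \<le> \<beta> * (k_iter K \<beta> c w j (evolve c w) - ?S)"
        using S beta by simp
      moreover have "\<beta> * \<delta> \<le> 1 * 1" using beta \<delta> by (intro mult_mono) auto
      ultimately show ?thesis unfolding approx_den_def by linarith
    qed
  qed
  thus ?thesis using \<delta> beta by (intro exI[of _ "\<beta> * \<delta>"]) auto
qed

section \<open>Threshold policies and the error of the iteration\<close>

lemma opt_value_waiting:
  assumes x: "0 \<le> x" "x \<le> 1"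
    and rest: "\<And>y. 0 \<le> y \<Longrightarrow> y \<le> w \<Longrightarrow> y \<le> 1 \<Longrightarrow> opt_value \<beta> m c y = value_passive \<beta> m c y"
    and below: "\<And>k. k < n \<Longrightarrow> (evolve c ^^ k) x \<le> w"
  shows "opt_value \<beta> m c x = m * ((1 - \<beta> ^ n) / (1 - \<beta>)) + \<beta> ^ n * opt_value \<beta> m c ((evolve c ^^ n) x)"
  using below
proof (induction n)
  case (Suc n)
  let ?y = "(evolve c ^^ n) x"
  have "opt_value \<beta> m c ?y = m + \<beta> * opt_value \<beta> m c (evolve c ?y)"
    using rest[of ?y] evolve_funpow_range[OF x] Suc.prems by (simp add: value_passive_def)
  moreover have "opt_value \<beta> m c x = m * ((1 - \<beta> ^ n) / (1 - \<beta>)) + \<beta> ^ n * opt_value \<beta> m c ?y"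
    using Suc by simp
  moreover have "(1 - \<beta> ^ Suc n) / (1 - \<beta>) = (1 - \<beta> ^ n) / (1 - \<beta>) + \<beta> ^ n"
  proof -
    have "(1 - \<beta> ^ Suc n) / (1 - \<beta>) = (1 - \<beta> ^ n + \<beta> ^ n * (1 - \<beta>)) / (1 - \<beta>)"
      by (simp add: algebra_simps)
    thus ?thesis using beta by (simp add: add_divide_distrib)
  qed
  ultimately show ?case by (simp add: distrib_left mult_ac)
qed simp

text \<open>At a subsidy for which both actions are optimal in \<open>w\<close>, monotonicity of the advantage
  makes passivity optimal at all beliefs up to \<open>w\<close> and activation optimal above. Hence the optimal
  value satisfies the equation of which \<open>m * k_iter + a_iter\<close> is the fixed-point iteration.\<close>

lemma opt_value_threshold_equation:
  assumes d: "\<beta> * \<bar>p11 c - p01 c\<bar> \<le> 1 / 2" and w: "0 \<le> w" "w \<le> 1" and zero: "advantage m w = 0"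
    and x: "0 \<le> x" "x \<le> 1"
  shows "opt_value \<beta> m c x = m * b1 \<beta> c w x + b2 \<beta> c w x * hit_belief c w x
           + (\<Sum>i=1..K. b3 \<beta> c w i x * opt_value \<beta> m c (next_belief c w i x))"
proof -
  have rest: "opt_value \<beta> m c y = value_passive \<beta> m c y" if "0 \<le> y" "y \<le> w" "y \<le> 1" for y
    using advantage_mono[OF d that(1,2) w(2), of m] bellman_equation[OF that(1,3), of m] zero
    by (simp add: advantage_def)
  have act: "opt_value \<beta> m c y = value_active K \<beta> m c y" if "w \<le> y" "y \<le> 1" for y
    using advantage_mono[OF d w(1) that, of m] bellman_equation[OF order.trans[OF w(1) that(1)] that(2), of m] zero
    by (simp add: advantage_def)
  show ?thesis
  proof (cases rule: hit_cases[of c w x])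
    case never
    \<comment> \<open>The belief never exceeds the threshold, so the value is that of waiting for ever.\<close>
    have pow: "(\<lambda>n. \<beta> ^ n) \<longlonglongrightarrow> 0" using beta by (intro LIMSEQ_realpow_zero) auto
    have null: "(\<lambda>n. \<beta> ^ n * opt_value \<beta> m c ((evolve c ^^ n) x)) \<longlonglongrightarrow> 0"
    proof (rule Lim_null_comparison)
      have "\<bar>\<beta> ^ n * opt_value \<beta> m c ((evolve c ^^ n) x)\<bar> \<le> \<beta> ^ n * value_bound m" for n
        using beta abs_opt_value_le[OF evolve_funpow_range[OF x], of m n]
        unfolding abs_mult by (intro mult_mono) auto
      thus "\<forall>\<^sub>F n in sequentially. norm (\<beta> ^ n * opt_value \<beta> m c ((evolve c ^^ n) x)) \<le> \<beta> ^ n * value_bound m"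
        by (intro always_eventually allI) (simp only: real_norm_def)
      show "(\<lambda>n. \<beta> ^ n * value_bound m) \<longlonglongrightarrow> 0"
        by (rule tendsto_mult_left_zero[OF pow])
    qed
    have lim: "(\<lambda>n. m * ((1 - \<beta> ^ n) / (1 - \<beta>)) + \<beta> ^ n * opt_value \<beta> m c ((evolve c ^^ n) x))
        \<longlonglongrightarrow> m * ((1 - 0) / (1 - \<beta>)) + 0"
      using beta by (intro tendsto_add tendsto_mult tendsto_divide tendsto_diff tendsto_const pow null) auto
    have const: "(\<lambda>n. m * ((1 - \<beta> ^ n) / (1 - \<beta>)) + \<beta> ^ n * opt_value \<beta> m c ((evolve c ^^ n) x))
        = (\<lambda>n. opt_value \<beta> m c x)"
      by (rule ext) (rule opt_value_waiting[OF x rest never(2), symmetric])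
    have "opt_value \<beta> m c x = m * ((1 - 0) / (1 - \<beta>)) + 0"
      using lim unfolding const LIMSEQ_const_iff .
    thus ?thesis by (simp add: never(1) b1_def b2_def b3_def disc_def)
  next
    case (hit l)
    let ?y = "(evolve c ^^ l) x"
    have "opt_value \<beta> m c ?y = ?y + \<beta> * (\<Sum>i=1..K. obs_prob c i ?y * opt_value \<beta> m c (post_evolve c i ?y))"
      unfolding value_active_def[symmetric] using hit(2) by (intro act evolve_funpow_range x less_imp_le)
    moreover have "opt_value \<beta> m c x = m * ((1 - \<beta> ^ l) / (1 - \<beta>)) + \<beta> ^ l * opt_value \<beta> m c ?y"
      by (rule opt_value_waiting[OF x rest hit(3)])
    moreover have "(\<Sum>i=1..K. b3 \<beta> c w i x * opt_value \<beta> m c (next_belief c w i x)) =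
        \<beta> ^ l * (\<beta> * (\<Sum>i=1..K. obs_prob c i ?y * opt_value \<beta> m c (post_evolve c i ?y)))"
      unfolding sum_distrib_left
      by (intro sum.cong) (simp_all add: hit(1) b3_def disc_def hit_belief_def next_belief_def)
    moreover have b: "b1 \<beta> c w x = (1 - \<beta> ^ l) / (1 - \<beta>)" "b2 \<beta> c w x = \<beta> ^ l" "hit_belief c w x = ?y"
      by (simp_all add: hit(1) b1_def b2_def disc_def hit_belief_def)
    moreover from calculation(1) have "\<beta> ^ l * opt_value \<beta> m c ?y = \<beta> ^ l * ?y +
        \<beta> ^ l * (\<beta> * (\<Sum>i=1..K. obs_prob c i ?y * opt_value \<beta> m c (post_evolve c i ?y)))"
      by (simp only: distrib_left)
    ultimately show ?thesis unfolding b by linarith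
  qed
qed

text \<open>The threshold equation is a contraction: the factors \<open>b3\<close> are nonnegative with sum
  at most \<open>\<beta>\<close>. The zeroth iterate drops the sum over the observations and so has error at most
  \<open>\<beta>\<close> times the bound of the optimal value.\<close>

lemma iteration_error:
  assumes d: "\<beta> * \<bar>p11 c - p01 c\<bar> \<le> 1 / 2" and w: "0 \<le> w" "w \<le> 1" and zero: "advantage m w = 0"
    and x: "0 \<le> x" "x \<le> 1"
  shows "\<bar>opt_value \<beta> m c x - (m * k_iter K \<beta> c w j x + a_iter K \<beta> c w j x)\<bar> \<le> \<beta> ^ Suc j * value_bound m"
  using x
proof (induction j arbitrary: x)
  note eq = opt_value_threshold_equation[OF d w zero]
  have contract: "\<bar>\<Sum>i=1..K. b3 \<beta> c w i x * g i\<bar> \<le> \<beta> * r"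
    if x: "0 \<le> x" "x \<le> 1" and g: "\<And>i. \<bar>g i\<bar> \<le> r" for x g r
  proof -
    have r: "0 \<le> r" using g[of 0] by linarith
    have "\<bar>\<Sum>i=1..K. b3 \<beta> c w i x * g i\<bar> \<le> (\<Sum>i=1..K. b3 \<beta> c w i x * r)"
      using g b3_nonneg[OF x] by (intro sum_abs[THEN order.trans] sum_mono) (auto simp: abs_mult intro!: mult_left_mono)
    also have "\<dots> = \<beta> * disc \<beta> (hit c w x) * r" unfolding sum_distrib_right[symmetric] sum_b3 ..
    also have "\<dots> \<le> \<beta> * 1 * r" using beta r disc_range by (intro mult_right_mono mult_left_mono) auto
    finally show ?thesis by simp
  qed
  {
    case 0
    have "opt_value \<beta> m c x - (m * k_iter K \<beta> c w 0 x + a_iter K \<beta> c w 0 x)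
        = (\<Sum>i=1..K. b3 \<beta> c w i x * opt_value \<beta> m c (next_belief c w i x))"
      unfolding k_iter.simps a_iter.simps using eq[OF 0] by linarith
    also have "\<bar>\<dots>\<bar> \<le> \<beta> * value_bound m"
      by (rule contract[OF 0 abs_opt_value_le[OF next_belief_range[OF 0]]])
    finally show ?case by (simp only: power_Suc power_0 mult_1_right)
  next
    case (Suc j)
    let ?e = "\<lambda>y. opt_value \<beta> m c y - (m * k_iter K \<beta> c w j y + a_iter K \<beta> c w j y)"
    let ?n = "\<lambda>i. next_belief c w i x"
    have "b3 \<beta> c w i x * ?e (?n i) = b3 \<beta> c w i x * opt_value \<beta> m c (?n i) -
        (m * (b3 \<beta> c w i x * k_iter K \<beta> c w j (?n i)) + b3 \<beta> c w i x * a_iter K \<beta> c w j (?n i))" for i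
      by (simp add: algebra_simps)
    hence "(\<Sum>i=1..K. b3 \<beta> c w i x * ?e (?n i)) = (\<Sum>i=1..K. b3 \<beta> c w i x * opt_value \<beta> m c (?n i)) -
        (m * (\<Sum>i=1..K. b3 \<beta> c w i x * k_iter K \<beta> c w j (?n i))
          + (\<Sum>i=1..K. b3 \<beta> c w i x * a_iter K \<beta> c w j (?n i)))"
      by (simp only: sum_subtractf sum.distrib sum_distrib_left)
    hence "opt_value \<beta> m c x - (m * k_iter K \<beta> c w (Suc j) x + a_iter K \<beta> c w (Suc j) x)
        = (\<Sum>i=1..K. b3 \<beta> c w i x * ?e (?n i))"
      unfolding k_iter.simps a_iter.simps distrib_left using eq[OF Suc.prems] by linarith
    also have "\<bar>\<dots>\<bar> \<le> \<beta> * (\<beta> ^ Suc j * value_bound m)"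
      by (rule contract[OF Suc.prems Suc.IH[OF next_belief_range[OF Suc.prems]]])
    finally show ?case by (simp only: power_Suc mult.assoc)
  }
qed

lemma index_identity:
  fixes a b k m v w sa sk sv :: real
  shows "m * (1 + b * (k - sk)) - (w + b * (sa - a))
    = b * ((sv - (m * sk + sa)) - (v - (m * k + a))) - ((w + b * sv) - (m + b * v))"
  by (simp add: algebra_simps)

text \<open>The subsidy solves \<open>advantage m w = 0\<close>. With the optimal value replaced by
  \<open>m * k_iter + a_iter\<close>, this equation becomes \<open>m * approx_den = approx_num\<close>, so that the
  residual consists of errors of the iteration only.\<close>

lemma approx_index_equation_error:
  assumes d: "\<beta> * \<bar>p11 c - p01 c\<bar> \<le> 1 / 2" and w: "0 \<le> w" "w \<le> 1" and zero: "advantage m w = 0"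
  shows "\<bar>m * approx_den K \<beta> j c w - approx_num K \<beta> j c w\<bar> \<le> 2 * value_bound m * \<beta> ^ j"
proof -
  let ?e = "\<lambda>y. opt_value \<beta> m c y - (m * k_iter K \<beta> c w j y + a_iter K \<beta> c w j y)"
  let ?E = "\<beta> ^ Suc j * value_bound m"
  have e: "\<bar>?e y\<bar> \<le> ?E" if "0 \<le> y" "y \<le> 1" for y
    by (rule iteration_error[OF d w zero that])
  let ?s = "\<Sum>i=1..K. obs_prob c i w * ?e (post_evolve c i w)"
  have "\<bar>?s\<bar> \<le> (\<Sum>i=1..K. obs_prob c i w * ?E)"
    using e[OF post_evolve_range[OF w]] obs_prob_nonneg[OF w]
    by (intro sum_abs[THEN order.trans] sum_mono) (auto simp: abs_mult intro!: mult_left_mono)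
  also have "\<dots> = ?E" unfolding sum_distrib_right[symmetric] by (simp only: sum_obs_prob mult_1)
  finally have s: "\<bar>?s\<bar> \<le> ?E" .
  let ?z = "\<lambda>i. post_evolve c i w"
  have "obs_prob c i w * ?e (?z i) = obs_prob c i w * opt_value \<beta> m c (?z i) -
      (m * (obs_prob c i w * k_iter K \<beta> c w j (?z i)) + obs_prob c i w * a_iter K \<beta> c w j (?z i))" for i
    by (simp add: algebra_simps)
  hence "?s = (\<Sum>i=1..K. obs_prob c i w * opt_value \<beta> m c (?z i)) -
      (m * (\<Sum>i=1..K. obs_prob c i w * k_iter K \<beta> c w j (?z i))
        + (\<Sum>i=1..K. obs_prob c i w * a_iter K \<beta> c w j (?z i)))"
    by (simp only: sum_subtractf sum.distrib sum_distrib_left)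
  hence "m * approx_den K \<beta> j c w - approx_num K \<beta> j c w
      = \<beta> * (?s - ?e (evolve c w)) - advantage m w"
    unfolding approx_den_def approx_num_def advantage_def value_active_def value_passive_def
    by (simp only: index_identity)
  hence eq: "m * approx_den K \<beta> j c w - approx_num K \<beta> j c w = \<beta> * (?s - ?e (evolve c w))"
    by (simp only: zero diff_0_right)
  have "\<bar>m * approx_den K \<beta> j c w - approx_num K \<beta> j c w\<bar> = \<beta> * \<bar>?s - ?e (evolve c w)\<bar>"
    unfolding eq abs_mult using beta by simp
  also have "\<dots> \<le> 1 * (2 * ?E)"
  proof (rule mult_mono)
    show "\<bar>?s - ?e (evolve c w)\<bar> \<le> 2 * ?E" using s e[OF evolve_range[OF w]] by linarith
  qed (use beta in auto)
  also have "\<dots> \<le> 2 * value_bound m * \<beta> ^ j"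
  proof -
    have "\<beta> ^ Suc j * value_bound m \<le> \<beta> ^ j * value_bound m"
      using beta by (intro mult_right_mono power_decreasing) (auto simp: value_bound_def)
    moreover have "2 * value_bound m * \<beta> ^ j = 2 * (\<beta> ^ j * value_bound m)" by simp
    ultimately show ?thesis by linarith
  qed
  finally show ?thesis .
qed

section \<open>Convergence to the Whittle index\<close>

lemma continuous_on_advantage:
  assumes w: "0 \<le> w" "w \<le> 1" shows "continuous_on A (\<lambda>m. advantage m w)"
proof -
  have V: "continuous_on A (\<lambda>m. opt_value \<beta> m c x)" if "0 \<le> x" "x \<le> 1" for x
  proof (rule lipschitz_on_continuous_on)
    show "(1 / (1 - \<beta>))-lipschitz_on A (\<lambda>m. opt_value \<beta> m c x)"
      using opt_value_lipschitz_subsidy[OF that] beta by (intro lipschitz_onI) (auto simp: dist_real_def)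
  qed
  show ?thesis
    unfolding advantage_def value_active_def value_passive_def
    by (intro continuous_intros V post_evolve_range evolve_range w)
qed

text \<open>With subsidy 1 nothing is gained by activation, and with subsidy \<open>- 1 / (1 - \<beta>)\<close> a
  passive slot costs more than all later rewards; the intermediate value theorem does the rest.
  The bound on \<open>m\<close> makes the constant of the convergence uniform in the belief.\<close>

lemma advantage_zero_exists:
  assumes w: "0 \<le> w" "w \<le> 1"
  shows "\<exists>m. advantage m w = 0 \<and> \<bar>m\<bar> \<le> 1 / (1 - \<beta>)"
proof -
  let ?m = "- (1 / (1 - \<beta>))"
  have le: "1 \<le> 1 / (1 - \<beta>)" using beta by simp
  have "advantage 1 w \<le> 0"
  proof -
    have "(\<Sum>i=1..K. obs_prob c i w * opt_value \<beta> 1 c (post_evolve c i w)) = 1 / (1 - \<beta>)"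
      unfolding opt_value_subsidy_1[OF post_evolve_range[OF w]] sum_distrib_right[symmetric]
      by (simp only: sum_obs_prob mult_1)
    thus ?thesis using w by (simp add: advantage_def value_active_def value_passive_def
          opt_value_subsidy_1 evolve_range)
  qed
  moreover have "0 \<le> advantage ?m w"
  proof -
    have "0 \<le> (\<Sum>i=1..K. obs_prob c i w * opt_value \<beta> ?m c (post_evolve c i w))"
      using w by (intro sum_nonneg mult_nonneg_nonneg obs_prob_nonneg opt_value_nonneg post_evolve_range)
    hence "w \<le> value_active K \<beta> ?m c w" using beta by (simp add: value_active_def)
    moreover have "\<beta> * opt_value \<beta> ?m c (evolve c w) \<le> 1 * (1 / (1 - \<beta>))"
      using beta le by (intro mult_mono opt_value_le opt_value_nonneg evolve_range w) linarith+
    hence "value_passive \<beta> ?m c w \<le> 0" by (simp add: value_passive_def)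
    ultimately show ?thesis using w by (simp add: advantage_def)
  qed
  ultimately obtain m where "?m \<le> m" "m \<le> 1" "advantage m w = 0"
    using IVT2'[of "\<lambda>m. advantage m w" 1 0 ?m] continuous_on_advantage[OF w] le by fastforce
  thus ?thesis using le by (intro exI[of _ m]) auto
qed

text \<open>Every zero of the advantage is the limit of the same sequence of approximated indices.
  So there is exactly one, and the infimum in the definition of the Whittle index is this
  zero.\<close>

theorem priority_index_converges:
  assumes half: "\<beta> \<le> 1 / 2"
  shows "\<exists>C. \<forall>w\<in>{0..1}. \<forall>j. \<bar>priority_index K \<beta> j c w - whittle_index K \<beta> c w\<bar> \<le> C * \<beta> ^ j"
proof -
  have "\<beta> * \<bar>p11 c - p01 c\<bar> \<le> 1 / 2 * 1"
    using half transition_probs by (intro mult_mono) auto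
  hence d: "\<beta> * \<bar>p11 c - p01 c\<bar> \<le> 1 / 2" by simp
  obtain \<delta> where \<delta>: "0 < \<delta>" and den: "\<And>w j. 0 \<le> w \<Longrightarrow> w \<le> 1 \<Longrightarrow> \<delta> \<le> approx_den K \<beta> j c w"
    using approx_den_lower_bound[OF half] by blast
  define R where "R = (1 / (1 - \<beta>)) / (1 - \<beta>)"
  have "\<bar>priority_index K \<beta> j c w - whittle_index K \<beta> c w\<bar> \<le> \<bar>bw c\<bar> * (2 * R / \<delta>) * \<beta> ^ j"
    if "w \<in> {0..1}" for w j
  proof -
    have w: "0 \<le> w" "w \<le> 1" using that by auto
    let ?q = "\<lambda>j. approx_num K \<beta> j c w / approx_den K \<beta> j c w"
    have den_pos: "0 < approx_den K \<beta> j c w" for j using den[OF w, of j] \<delta> by linarith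
    have err: "\<bar>?q j - m\<bar> \<le> (2 * value_bound m / \<delta>) * \<beta> ^ j" if "advantage m w = 0" for m j
    proof -
      let ?D = "approx_den K \<beta> j c w" and ?N = "approx_num K \<beta> j c w"
      have "\<bar>?q j - m\<bar> = \<bar>m * ?D - ?N\<bar> / ?D"
        using den_pos[of j] by (simp add: abs_divide[symmetric] abs_minus_commute[of m] field_simps)
      also have "\<dots> \<le> (2 * value_bound m * \<beta> ^ j) / \<delta>"
        using approx_index_equation_error[OF d w that, of j] den[OF w, of j] \<delta> by (intro frac_le) linarith+
      finally show ?thesis by simp
    qed
    have lim: "?q \<longlonglongrightarrow> m" if "advantage m w = 0" for m
    proof (rule LIM_zero_cancel, rule Lim_null_comparison)
      show "\<forall>\<^sub>F j in sequentially. norm (?q j - m) \<le> (2 * value_bound m / \<delta>) * \<beta> ^ j"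
        using err[OF that] by simp
      show "(\<lambda>j. (2 * value_bound m / \<delta>) * \<beta> ^ j) \<longlonglongrightarrow> 0"
        using beta by (intro tendsto_mult_right_zero LIMSEQ_realpow_zero) auto
    qed
    obtain m where m: "advantage m w = 0" "\<bar>m\<bar> \<le> 1 / (1 - \<beta>)"
      using advantage_zero_exists[OF w] by blast
    have "{m. value_active K \<beta> m c w = value_passive \<beta> m c w} = {m}"
      using m(1) LIMSEQ_unique[OF lim lim] by (auto simp: advantage_def)
    hence "whittle_index K \<beta> c w = bw c * m" by (simp add: whittle_index_def)
    moreover have "priority_index K \<beta> j c w = bw c * ?q j"
      using den_pos[of j] by (simp add: priority_index_def)
    ultimately have "\<bar>priority_index K \<beta> j c w - whittle_index K \<beta> c w\<bar> = \<bar>bw c\<bar> * \<bar>?q j - m\<bar>"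
      by (simp only: right_diff_distrib[symmetric] abs_mult)
    also have "\<dots> \<le> \<bar>bw c\<bar> * ((2 * R / \<delta>) * \<beta> ^ j)"
    proof (intro mult_left_mono order.trans[OF err[OF m(1)]])
      have "value_bound m \<le> R" unfolding value_bound_def R_def
        using m(2) beta by (intro divide_right_mono) auto
      thus "(2 * value_bound m / \<delta>) * \<beta> ^ j \<le> (2 * R / \<delta>) * \<beta> ^ j"
        using \<delta> beta by (intro mult_right_mono divide_right_mono) auto
    qed simp
    finally show ?thesis by (simp add: mult_ac)
  qed
  thus ?thesis by blast
qed

end

section \<open>Complexity and convergence of the algorithm\<close>

theorem theorem5:
  fixes K :: nat
  assumes "1 \<le> K"
  shows "(2 \<le> K \<longrightarrow> (\<exists>C::real. \<forall>j N M T \<beta> cs ws env. awi_input K N M T \<beta> cs ws env \<longrightarrow>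
             real (time (awi_tm K \<beta> j M T cs ws env)) \<le> C * (real N * real T * real K ^ j))) \<and>
         (\<forall>j. \<exists>C::real. \<forall>N M T \<beta> cs ws env. awi_input K N M T \<beta> cs ws env \<longrightarrow>
             real (time (awi_tm K \<beta> j M T cs ws env)) \<le> C * (real N * real T * real K ^ j)) \<and>
         (\<forall>c \<beta>. valid_channel K c \<and> 0 < \<beta> \<and> \<beta> \<le> 1/2 \<and> \<beta> \<le> discount_bound K c \<longrightarrow>
             (\<exists>C \<rho>::real. 0 < \<rho> \<and> \<rho> < 1 \<and>
                (\<forall>w\<in>{0..1}. \<forall>j. \<bar>priority_index K \<beta> j c w - whittle_index K \<beta> c w\<bar> \<le> C * \<rho> ^ j)))"
proof (intro conjI impI allI)
  show "\<exists>C::real. \<forall>j N M T \<beta> cs ws env. awi_input K N M T \<beta> cs ws env \<longrightarrow>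
             real (time (awi_tm K \<beta> j M T cs ws env)) \<le> C * (real N * real T * real K ^ j)" if "2 \<le> K"
    by (rule awi_complexity(1)[OF assms that])
  show "\<exists>C::real. \<forall>N M T \<beta> cs ws env. awi_input K N M T \<beta> cs ws env \<longrightarrow>
             real (time (awi_tm K \<beta> j M T cs ws env)) \<le> C * (real N * real T * real K ^ j)" for j
    by (rule awi_complexity(2)[OF assms])
  fix c :: channel and \<beta> :: real
  assume h: "valid_channel K c \<and> 0 < \<beta> \<and> \<beta> \<le> 1/2 \<and> \<beta> \<le> discount_bound K c"
  then interpret discounted_channel K c \<beta> by unfold_locales auto
  show "\<exists>C \<rho>::real. 0 < \<rho> \<and> \<rho> < 1 \<and>
                (\<forall>w\<in>{0..1}. \<forall>j. \<bar>priority_index K \<beta> j c w - whittle_index K \<beta> c w\<bar> \<le> C * \<rho> ^ j)"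
    using priority_index_converges h beta by blast
qed

end
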